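(* Let $a>0$, $b>0$, $F_x\ge0$, $F_y\ge0$, and let $V_F:\mathbb{R}^2\to\mathbb{R}$, $$V_F(x,y)=\tfrac14r^4-\tfrac12r^2-ax^2+by^2+F_xx+F_yy,\qquad r=\sqrt{x^2+y^2}.$$ With the constants defined in the context, the positions and nature of the critical points of $V_F$ are as follows. (A) $F_x=0$, $F_y=0$, $b<\frac12$: $(0,0)$ hill; $(\pm\sqrt{1+2a},0)$ wells; $(0,\pm\sqrt{1-2b})$ saddles. (B) $F_x=0$, $F_y=0$, $b\ge\frac12$: $(0,0)$ saddle; $(\pm\sqrt{1+2a},0)$ wells. (C) $F_x>0$, $F_y=0$, $b<\frac12$. For any $F_x>0$, $(x_0,0)$ is a well. Moreover: - if $F_x<F_x^{sad}$: $(x_1,0)$ well, $(x_2,0)$ hill, $(x_{saddle},\pm y_{saddle})$ saddles; - if $F_x^{sad}<F_x<F_x^{crit}$: when $\sqrt{1-2b}\in R_1$, $(x_1,0)$ is a saddle and $(x_2,0)$ a hill; when $\sqrt{1-2b}\in R_2$, $(x_1,0)$ is a well and $(x_2,0)$ a saddle; in both cases $(x_{saddle},\pm y_{saddle})$ are nonexistent; - if $F_x=F_x^{sad}<F_x^{crit}$: when $\sqrt{1-2b}\in R_1$, $(x_1,0)$ is unidentified and $(x_2,0)$ is a hill; when $\sqrt{1-2b}\in R_2$, $(x_1,0)$ is a well and $(x_2,0)$ is unidentified; $(x_{saddle},\pm y_{saddle})$ is unidentified; - if $F_x=F_x^{crit}$: $(x_1,0)$ and $(x_2,0)$ unidentified;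 - if $F_x>F_x^{crit}$: $(x_1,0)$ and $(x_2,0)$ nonexistent. (D) $F_x>0$, $F_y=0$, $b\ge\frac12$: - if $F_x<F_x^{crit}$: $(x_0,0)$ well, $(x_1,0)$ well, $(x_2,0)$ saddle; - if $F_x>F_x^{crit}$: $(x_0,0)$ well, $(x_1,0)$ and $(x_2,0)$ nonexistent; - if $F_x=F_x^{crit}$: $(x_0,0)$ well, $(x_1,0)$ and $(x_2,0)$ unidentified. (E) $F_x=0$, $F_y>0$, $b<\frac12$: - if $F_y<F_y^{crit}$: $(0,y_1)$ saddle, $(0,y_2)$ hill; - if $F_y<F_y^{sad}$: $(0,y_0)$ saddle, $(\pm x_{well},y_{well})$ wells; - if $F_y>F_y^{crit}$: $(0,y_1)$ and $(0,y_2)$ nonexistent; - if $F_y>F_y^{sad}$: $(0,y_0)$ well, $(\pm x_{well},y_{well})$ nonexistent; - if $F_y=F_y^{crit}$: $(0,y_1)$ and $(0,y_2)$ unidentified; - if $F_y=F_y^{sad}$: $(0,y_0)$ and $(\pm x_{well},y_{well})$ unidentified. (F) $F_x=0$, $F_y>0$, $b\ge\frac12$: - if $F_y<F_y^{sad}$: $(0,y_0)$ saddle, $(\pm x_{well},y_{well})$ wells; - if $F_y=F_y^{sad}$: $(0,y_0)=(\pm x_{well},y_{well})$, unidentified; - if $F_y>F_y^{sad}$: $(0,y_0)$ well, $(\pm x_{well},y_{well})$ nonexistent.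
   Context: Terminology: a critical point is a point where $\partial V_F/\partial x=\partial V_F/\partial y=0$; a well is a strict local minimum, a hill a strict local maximum, a saddle a critical point that is neither a local minimum nor a local maximum. "Unidentified" means the point is a critical point but no assertion is made about its nature; "nonexistent" means the formula gives no real point, so there is no such critical point. In each case the listed existing points (which may coincide when unidentified) are all the critical points of $V_F$. Constants: for $k=0,1,2$, $$x_k=-\frac{2}{\sqrt3}\sqrt{1+2a}\,\cos\left\{\frac13\tan^{-1}\left(\frac{\sqrt{4(1+2a)^3-27F_x^2}}{F_x\sqrt{27}}\right)+\frac{2\pi}{3}k\right\},$$ and, for $b<\frac12$, $$y_k=-\frac{2}{\sqrt3}\sqrt{1-2b}\,\cos\left\{\frac13\tan^{-1}\left(\frac{\sqrt{4(1-2b)^3-27F_y^2}}{F_y\sqrt{27}}\right)+\frac{2\pi}{3}k\right\}.$$ When the quantity under the inner square root is negative, $\sqrt{-c}=i\sqrt{c}$ and $\tan^{-1}$ is the principal complex arctangent, $\tan^{-1}(z)=\frac{i}{2}\{\ln(1-iz)-\ln(1+iz)\}$. For $b\ge\frac12$, $y_0$ denotes the unique real root of $y^3-(1-2b)y+F_y=0$. Further $$x_{saddle}=\frac{F_x}{2(a+b)},\quad y_{saddle}=\sqrt{(1-2b)-\left(\frac{F_x}{2(a+b)}\right)^2},$$ $$x_{well}=\sqrt{(1+2a)-\left(\frac{F_y}{2(a+b)}\right)^2},\quad y_{well}=\frac{-F_y}{2(a+b)},$$ $$F_x^{crit}=\sqrt{\frac{4(1+2a)^3}{27}},\quad F_x^{sad}=2(a+b)\sqrt{1-2b},\quad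 F_y^{crit}=\sqrt{\frac{4(1-2b)^3}{27}},\quad F_y^{sad}=2(a+b)\sqrt{1+2a},$$ $$R_1=\left(\tfrac{1}{\sqrt3}\sqrt{1+2a},\sqrt{1+2a}\right),\qquad R_2=\left(0,\tfrac{1}{\sqrt3}\sqrt{1+2a}\right).$$ ($F_x^{sad}$ and $F_y^{crit}$ are used only when $b<\frac12$.) *)

theory Defs
  imports "HOL-Analysis.Analysis"
begin

section \<open>The potential and its critical points\<close>

definition V_F :: "real \<Rightarrow> real \<Rightarrow> real \<Rightarrow> real \<Rightarrow> real \<times> real \<Rightarrow> real" where
  "V_F a b Fx Fy = (\<lambda>(x, y). let r = sqrt (x^2 + y^2) in
     1/4 * r^4 - 1/2 * r^2 - a * x^2 + b * y^2 + Fx * x + Fy * y)"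

definition critical_point :: "(real \<times> real \<Rightarrow> real) \<Rightarrow> real \<times> real \<Rightarrow> bool" where
  "critical_point V = (\<lambda>(x, y).
     ((\<lambda>t. V (t, y)) has_real_derivative 0) (at x) \<and>
     ((\<lambda>t. V (x, t)) has_real_derivative 0) (at y))"

definition local_minimum :: "(real \<times> real \<Rightarrow> real) \<Rightarrow> real \<times> real \<Rightarrow> bool" where
  "local_minimum V p \<longleftrightarrow> (\<forall>\<^sub>F q in at p. V p \<le> V q)"

definition local_maximum :: "(real \<times> real \<Rightarrow> real) \<Rightarrow> real \<times> real \<Rightarrow> bool" where
  "local_maximum V p \<longleftrightarrow> (\<forall>\<^sub>F q in at p. V q \<le> V p)"

definition well :: "(real \<times> real \<Rightarrow> real) \<Rightarrow> real \<times> real \<Rightarrow> bool" where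
  "well V p \<longleftrightarrow> (\<forall>\<^sub>F q in at p. V p < V q)"

definition hill :: "(real \<times> real \<Rightarrow> real) \<Rightarrow> real \<times> real \<Rightarrow> bool" where
  "hill V p \<longleftrightarrow> (\<forall>\<^sub>F q in at p. V q < V p)"

definition saddle :: "(real \<times> real \<Rightarrow> real) \<Rightarrow> real \<times> real \<Rightarrow> bool" where
  "saddle V p \<longleftrightarrow> critical_point V p \<and> \<not> local_minimum V p \<and> \<not> local_maximum V p"

section \<open>Points given by formulas\<close>

text \<open>
  The formulas for the positions are evaluated in the complex numbers, so a listed point is a
  pair of complex numbers; the formula gives a real point iff the pair lies in the
  range of \<open>real_point\<close>.
\<close>

definition real_point :: "real \<times> real \<Rightarrow> complex \<times> complex" where
  "real_point = (\<lambda>(x, y). (complex_of_real x, complex_of_real y))"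

datatype nature = Well | Hill | Saddle | Unidentified | Nonexistent

fun has_nature :: "(real \<times> real \<Rightarrow> real) \<Rightarrow> complex \<times> complex \<Rightarrow> nature \<Rightarrow> bool" where
  "has_nature V z Well \<longleftrightarrow> (\<exists>p. z = real_point p \<and> well V p)"
| "has_nature V z Hill \<longleftrightarrow> (\<exists>p. z = real_point p \<and> hill V p)"
| "has_nature V z Saddle \<longleftrightarrow> (\<exists>p. z = real_point p \<and> saddle V p)"
| "has_nature V z Unidentified \<longleftrightarrow> (\<exists>p. z = real_point p \<and> critical_point V p)"
| "has_nature V z Nonexistent \<longleftrightarrow> z \<notin> range real_point"

text \<open>
  A list of formulas with their natures is a correct table for \<open>V\<close> if every entry has the stated
  nature, the existing entries are exactly the critical points of \<open>V\<close>, and two existing entries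
  denote the same point only if both are unidentified.
\<close>

definition critical_table ::
    "(real \<times> real \<Rightarrow> real) \<Rightarrow> ((complex \<times> complex) \<times> nature) list \<Rightarrow> bool" where
  "critical_table V T \<longleftrightarrow>
     (\<forall>(z, n) \<in> set T. has_nature V z n) \<and>
     real_point ` {p. critical_point V p} = {z. \<exists>n. (z, n) \<in> set T \<and> n \<noteq> Nonexistent} \<and>
     (\<forall>i < length T. \<forall>j < length T.
        i \<noteq> j \<and> fst (T ! i) = fst (T ! j) \<and> snd (T ! i) \<noteq> Nonexistent \<and> snd (T ! j) \<noteq> Nonexistent
        \<longrightarrow> snd (T ! i) = Unidentified \<and> snd (T ! j) = Unidentified)"

section \<open>The constants\<close>

text \<open>
  The library's principal complex arctangent is given by the usual difference of logarithms on
  the strip containing all arguments that occur below: these are real, or of the form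
  \<open>\<i> * t\<close> with \<open>t\<close> real and \<open>0 < t < 1\<close>.
\<close>

lemma Arctan_eq_Ln_diff:
  assumes "\<bar>Im z\<bar> < 1"
  shows "Arctan z = \<i> / 2 * (Ln (1 - \<i> * z) - Ln (1 + \<i> * z))"
proof -
  define u v where "u = 1 - \<i> * z" and "v = 1 + \<i> * z"
  have re: "Re u > 0" "Re v > 0"
    using assms by (auto simp: u_def v_def)
  then have nz: "u \<noteq> 0" "v \<noteq> 0" by auto
  have im: "\<bar>Im (Ln u)\<bar> < pi/2" "\<bar>Im (Ln v)\<bar> < pi/2"
    using re Re_Ln_pos_lt_imp by blast+
  have "Ln (exp (Ln u - Ln v)) = Ln u - Ln v"
    by (rule Ln_exp) (use im in auto)
  moreover have "exp (Ln u - Ln v) = u / v"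
    using nz by (simp add: exp_diff)
  ultimately show ?thesis
    by (simp add: Arctan_def u_def v_def)
qed

text \<open>
  The trigonometric formula for the roots of \<open>t^3 - c * t + F\<close>; \<open>csqrt\<close> is the principal square
  root, so that \<open>csqrt (- s) = \<i> * sqrt s\<close> for real \<open>s > 0\<close>.
\<close>

definition trig_root :: "real \<Rightarrow> real \<Rightarrow> nat \<Rightarrow> complex" where
  "trig_root c F k =
     - complex_of_real (2 / sqrt 3 * sqrt c) *
       cos (1/3 * Arctan (csqrt (complex_of_real (4 * c^3 - 27 * F^2)) / complex_of_real (F * sqrt 27))
            + complex_of_real (2 * pi / 3 * real k))"

definition xk :: "real \<Rightarrow> real \<Rightarrow> nat \<Rightarrow> complex" where
  "xk a Fx k = trig_root (1 + 2*a) Fx k"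

definition yk :: "real \<Rightarrow> real \<Rightarrow> nat \<Rightarrow> complex" where
  "yk b Fy k = trig_root (1 - 2*b) Fy k"

definition y0 :: "real \<Rightarrow> real \<Rightarrow> complex" where
  "y0 b Fy = (if b < 1/2 then yk b Fy 0
              else complex_of_real (THE y. y^3 - (1 - 2*b) * y + Fy = 0))"

definition x_saddle :: "real \<Rightarrow> real \<Rightarrow> real \<Rightarrow> complex" where
  "x_saddle a b Fx = complex_of_real (Fx / (2 * (a + b)))"

definition y_saddle :: "real \<Rightarrow> real \<Rightarrow> real \<Rightarrow> complex" where
  "y_saddle a b Fx = csqrt (complex_of_real ((1 - 2*b) - (Fx / (2 * (a + b)))^2))"

definition x_well :: "real \<Rightarrow> real \<Rightarrow> real \<Rightarrow> complex" where
  "x_well a b Fy = csqrt (complex_of_real ((1 + 2*a) - (Fy / (2 * (a + b)))^2))"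

definition y_well :: "real \<Rightarrow> real \<Rightarrow> real \<Rightarrow> complex" where
  "y_well a b Fy = complex_of_real (- Fy / (2 * (a + b)))"

definition Fx_crit :: "real \<Rightarrow> real" where
  "Fx_crit a = sqrt (4 * (1 + 2*a)^3 / 27)"

definition Fx_sad :: "real \<Rightarrow> real \<Rightarrow> real" where
  "Fx_sad a b = 2 * (a + b) * sqrt (1 - 2*b)"

definition Fy_crit :: "real \<Rightarrow> real" where
  "Fy_crit b = sqrt (4 * (1 - 2*b)^3 / 27)"

definition Fy_sad :: "real \<Rightarrow> real \<Rightarrow> real" where
  "Fy_sad a b = 2 * (a + b) * sqrt (1 + 2*a)"

definition R1 :: "real \<Rightarrow> real set" where
  "R1 a = {1 / sqrt 3 * sqrt (1 + 2*a) <..< sqrt (1 + 2*a)}"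

definition R2 :: "real \<Rightarrow> real set" where
  "R2 a = {0 <..< 1 / sqrt 3 * sqrt (1 + 2*a)}"

end

theory Submission
  imports Defs
begin

text \<open>
  Write \<open>A = 1 + 2*a\<close>, \<open>B = 1 - 2*b\<close> and \<open>r^2 = x^2 + y^2\<close>. The gradient of the potential has the components
  \<open>x * (r^2 - A) + Fx\<close> and \<open>y * (r^2 - B) + Fy\<close>, and \<open>A - B = 2*(a + b)\<close> is positive. In every case one of the
  forces vanishes, and the component without force factors: a critical point lies on a coordinate
  axis, where the other component is a depressed cubic, or on a circle \<open>r^2 = B\<close> or \<open>r^2 = A\<close>, where the
  other component becomes linear. This gives all critical points: the roots of one cubic, and at
  most two further points, related by reflection
  (\<open>critical_point_Fy_0_iff\<close>, \<open>critical_point_Fx_0_iff\<close>).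

  The natures come from the second-derivative test, which for this quartic polynomial follows from
  an exact Taylor expansion (\<open>V_F_expansion\<close>, \<open>V_F_well\<close>, \<open>V_F_hill\<close>, \<open>V_F_saddle\<close>). Off the axis in question
  the determinant of the Hessian has a constant sign: negative on \<open>r^2 = B\<close>, positive on \<open>r^2 = A\<close>. On the
  axes the Hessian is diagonal, with entries \<open>3*x^2 - A\<close> and \<open>x^2 - B\<close> on the x-axis, \<open>y^2 - A\<close> and \<open>3*y^2 - B\<close>
  on the y-axis. So everything depends on where the squared roots of the cubic lie relative to \<open>A\<close>
  and \<open>B\<close>, one of them divided by \<open>3\<close>.

  The threshold with \<open>3\<close> belongs to the turning point of the cubic. The triple-angle formula shows that
  the listed trigonometric expressions are the roots and how they lie relative to the turning point;
  below, at and above the critical force there are three, two and one real roots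
  (\<open>trig_roots_below_crit\<close>, \<open>trig_roots_at_crit\<close>, \<open>trig_roots_above_crit\<close>).

  The other threshold belongs to the saddle force. The value at \<open>sqrt B\<close> of the cubic on the x-axis is
  \<open>Fx - Fx_sad\<close>, and the value at \<open>- sqrt A\<close> of the cubic on the y-axis is \<open>Fy - Fy_sad\<close>; their signs locate
  \<open>sqrt B\<close> and \<open>- sqrt A\<close> among the roots. The same signs decide whether the circle carries critical
  points off the axis. For a force along the x-axis beyond the saddle force, \<open>sqrt B\<close> lies outside the
  interval between the two positive roots, and the regions \<open>R1\<close> and \<open>R2\<close> tell on which side. Only
  at the origin, in the absence of forces and for \<open>B = 0\<close>, is the Hessian singular at a point whose nature
  is asserted.
\<close>

section \<open>The second-derivative test for the potential\<close>

lemma V_F_eq_polynomial: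
  "V_F a b Fx Fy (x, y) =
     (x^2 + y^2)^2 / 4 - (1 + 2*a) / 2 * x^2 - (1 - 2*b) / 2 * y^2 + Fx * x + Fy * y"
proof -
  have "sqrt (x^2 + y^2) ^ 4 = (sqrt (x^2 + y^2) ^ 2) ^ 2"
    using power_mult[of "sqrt (x^2 + y^2)" 2 2] by (simp del: real_sqrt_pow2)
  also have "\<dots> = (x^2 + y^2)^2" by simp
  finally show ?thesis by (simp add: V_F_def Let_def field_simps)
qed

lemma critical_point_V_F_iff:
  "critical_point (V_F a b Fx Fy) (x, y) \<longleftrightarrow>
     x * (x^2 + y^2) - (1 + 2*a) * x + Fx = 0 \<and>
     y * (x^2 + y^2) - (1 - 2*b) * y + Fy = 0"
proof -
  have dx: "((\<lambda>t. V_F a b Fx Fy (t, y)) has_real_derivative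
      x * (x^2 + y^2) - (1 + 2*a) * x + Fx) (at x)"
    unfolding V_F_eq_polynomial by (auto intro!: derivative_eq_intros simp: field_simps power2_eq_square)
  have dy: "((\<lambda>t. V_F a b Fx Fy (x, t)) has_real_derivative
      y * (x^2 + y^2) - (1 - 2*b) * y + Fy) (at y)"
    unfolding V_F_eq_polynomial by (auto intro!: derivative_eq_intros simp: field_simps power2_eq_square)
  show ?thesis
    unfolding critical_point_def using dx dy by (auto dest: DERIV_unique)
qed

text \<open>
  The potential is a quartic polynomial, so its Taylor expansion at a critical point is an exact
  identity: half the Hessian form, with entries \<open>V\<^sub>x\<^sub>x = 3*x^2 + y^2 - (1 + 2*a)\<close>, \<open>V\<^sub>x\<^sub>y = 2*x*y\<close> and
  \<open>V\<^sub>y\<^sub>y = x^2 + 3*y^2 - (1 - 2*b)\<close>, a cubic and a quartic remainder. The second-derivative test below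
  is read off this identity, without general multivariate calculus.
\<close>

lemma V_F_expansion:
  assumes "critical_point (V_F a b Fx Fy) (x, y)"
  shows "V_F a b Fx Fy (x + u, y + v) - V_F a b Fx Fy (x, y) =
     ((3*x^2 + y^2 - (1 + 2*a)) * u^2 + 2 * (2*x*y) * u * v + (x^2 + 3*y^2 - (1 - 2*b)) * v^2) / 2
     + (x * u + y * v) * (u^2 + v^2) + (u^2 + v^2)^2 / 4"
proof -
  have Fx: "Fx = (1 + 2*a) * x - x * (x^2 + y^2)" and Fy: "Fy = (1 - 2*b) * y - y * (x^2 + y^2)"
    using assms unfolding critical_point_V_F_iff by linarith+
  show ?thesis unfolding V_F_eq_polynomial Fx Fy by (simp add: power2_eq_square field_simps)
qed

text \<open>
  The quotient of determinant and trace is a lower bound for the smaller eigenvalue: subtracting it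
  from both diagonal entries leaves a form with determinant \<open>c^2\<close> and still positive first entry.
\<close>

lemma quadratic_form_lower_bound:
  fixes p q s :: real
  assumes "p > 0" "p * q > s^2"
  obtains c where "c > 0" "\<And>u v. c * (u^2 + v^2) \<le> p * u^2 + 2 * s * u * v + q * v^2"
proof -
  have "p * q > 0" using assms(2) zero_le_power2[of s] by linarith
  then have q: "q > 0" using assms(1) by (simp add: zero_less_mult_iff)
  define c where "c = (p * q - s^2) / (p + q)"
  have c: "c > 0" using assms q by (simp add: c_def)
  have pc: "p - c > 0"
  proof -
    have "p - c = (p^2 + s^2) / (p + q)" using assms q by (simp add: c_def field_simps power2_eq_square)
    also have "\<dots> > 0" using assms q by (simp add: add_pos_nonneg)
    finally show ?thesis .
  qed
  have det: "(p - c) * (q - c) - s^2 = c^2"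
  proof -
    have "c * (p + q) = p * q - s^2" using assms q by (simp add: c_def)
    then show ?thesis by (simp add: algebra_simps power2_eq_square)
  qed
  have nonneg: "0 \<le> (p - c) * u^2 + 2 * s * u * v + (q - c) * v^2" for u v
  proof -
    have "(p - c) * ((p - c) * u^2 + 2 * s * u * v + (q - c) * v^2) =
       ((p - c) * u + s * v)^2 + ((p - c) * (q - c) - s^2) * v^2"
      by (simp add: algebra_simps power2_eq_square)
    also have "\<dots> \<ge> 0" unfolding det by simp
    finally show ?thesis using pc by (simp add: zero_le_mult_iff)
  qed
  have "c * (u^2 + v^2) \<le> p * u^2 + 2 * s * u * v + q * v^2" for u v
    using nonneg[of u v] by (simp add: algebra_simps)
  with c that show ?thesis by blast
qed

lemma abs_inner_le: "\<bar>x * u + y * v\<bar> \<le> (\<bar>x\<bar> + \<bar>y\<bar>) * sqrt (u^2 + v^2)" for x u y v :: real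
proof -
  have "\<bar>u\<bar> \<le> sqrt (u^2 + v^2)" "\<bar>v\<bar> \<le> sqrt (u^2 + v^2)" by auto
  then have "\<bar>x\<bar> * \<bar>u\<bar> + \<bar>y\<bar> * \<bar>v\<bar> \<le> \<bar>x\<bar> * sqrt (u^2 + v^2) + \<bar>y\<bar> * sqrt (u^2 + v^2)"
    by (intro add_mono mult_left_mono) auto
  moreover have "\<bar>x * u + y * v\<bar> \<le> \<bar>x\<bar> * \<bar>u\<bar> + \<bar>y\<bar> * \<bar>v\<bar>"
    using abs_triangle_ineq[of "x * u" "y * v"] by (simp only: abs_mult)
  ultimately show ?thesis by (simp add: distrib_right)
qed

text \<open>
  At distance \<open>n\<close> from the point the Hessian form contributes at least \<open>c/2 * n^2\<close>, the cubic
  remainder is at most \<open>M * n^3\<close> in absolute value, and the quartic one is nonnegative. So the radius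
  \<open>c / (2*M)\<close> works.
\<close>

lemma V_F_well:
  assumes crit: "critical_point (V_F a b Fx Fy) (x, y)"
    and pos: "3*x^2 + y^2 - (1 + 2*a) > 0"
    and det: "(3*x^2 + y^2 - (1 + 2*a)) * (x^2 + 3*y^2 - (1 - 2*b)) > (2*x*y)^2"
  shows "well (V_F a b Fx Fy) (x, y)"
proof -
  obtain c where c: "c > 0" and low: "\<And>u v. c * (u^2 + v^2) \<le>
     (3*x^2 + y^2 - (1 + 2*a)) * u^2 + 2 * (2*x*y) * u * v + (x^2 + 3*y^2 - (1 - 2*b)) * v^2"
    using quadratic_form_lower_bound[OF pos det] by blast
  define M where "M = \<bar>x\<bar> + \<bar>y\<bar> + 1"
  have M: "M > 0" by (simp add: M_def)
  have "V_F a b Fx Fy (x, y) < V_F a b Fx Fy q"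
    if "q \<noteq> (x, y)" and close: "dist q (x, y) < c / (2 * M)" for q
  proof -
    define u v where "u = fst q - x" and "v = snd q - y"
    have q: "q = (x + u, y + v)" by (simp add: u_def v_def)
    define n where "n = sqrt (u^2 + v^2)"
    have n2: "u^2 + v^2 = n^2" by (simp add: n_def)
    have n: "n > 0" using that(1) by (auto simp: n_def q sum_power2_gt_zero_iff)
    have "M * n < c / 2" using close M by (simp add: q dist_Pair_Pair dist_real_def n_def field_simps)
    moreover have "\<bar>x * u + y * v\<bar> \<le> M * n"
      using abs_inner_le[of x u y v] n by (simp add: M_def n_def[symmetric] distrib_right)
    ultimately have "0 < n^2 * (c / 2 + (x * u + y * v))" using n by (intro mult_pos_pos) auto
    also have "\<dots> \<le> V_F a b Fx Fy q - V_F a b Fx Fy (x, y)"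
    proof -
      define H where "H = (3*x^2 + y^2 - (1 + 2*a)) * u^2 + 2 * (2*x*y) * u * v + (x^2 + 3*y^2 - (1 - 2*b)) * v^2"
      have "c * n^2 \<le> H" using low[of u v] by (simp only: n2 H_def)
      moreover have "(n^2)^2 / 4 \<ge> 0" by simp
      moreover have "n^2 * (c / 2 + (x * u + y * v)) = (c * n^2) / 2 + (x * u + y * v) * n^2"
        by (simp add: algebra_simps)
      ultimately show ?thesis
        unfolding q V_F_expansion[OF crit] n2 H_def[symmetric] by linarith
    qed
    finally show ?thesis by simp
  qed
  then show ?thesis
    unfolding well_def eventually_at using c M by (intro exI[of _ "c / (2 * M)"]) auto
qed

text \<open>
  The quartic remainder now has the wrong sign. Within radius \<open>1\<close> it is at most \<open>n^3\<close>, which is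
  what the summand \<open>1\<close> of \<open>M\<close> leaves over after the cubic remainder has been estimated.
\<close>

lemma V_F_hill:
  assumes crit: "critical_point (V_F a b Fx Fy) (x, y)"
    and neg: "3*x^2 + y^2 - (1 + 2*a) < 0"
    and det: "(3*x^2 + y^2 - (1 + 2*a)) * (x^2 + 3*y^2 - (1 - 2*b)) > (2*x*y)^2"
  shows "hill (V_F a b Fx Fy) (x, y)"
proof -
  obtain c where c: "c > 0" and low: "\<And>u v. c * (u^2 + v^2) \<le>
     - (3*x^2 + y^2 - (1 + 2*a)) * u^2 + 2 * (- (2*x*y)) * u * v + - (x^2 + 3*y^2 - (1 - 2*b)) * v^2"
    using quadratic_form_lower_bound[of "- (3*x^2 + y^2 - (1 + 2*a))" "- (2*x*y)"
        "- (x^2 + 3*y^2 - (1 - 2*b))"] neg det by (auto simp only: minus_mult_minus power2_minus neg_0_less_iff_less)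
  define M where "M = \<bar>x\<bar> + \<bar>y\<bar> + 1"
  have M: "M \<ge> 1" by (simp add: M_def)
  have "V_F a b Fx Fy q < V_F a b Fx Fy (x, y)"
    if "q \<noteq> (x, y)" and close: "dist q (x, y) < min 1 (c / (2 * M))" for q
  proof -
    define u v where "u = fst q - x" and "v = snd q - y"
    have q: "q = (x + u, y + v)" by (simp add: u_def v_def)
    define n where "n = sqrt (u^2 + v^2)"
    have n2: "u^2 + v^2 = n^2" by (simp add: n_def)
    have n: "n > 0" using that(1) by (auto simp: n_def q sum_power2_gt_zero_iff)
    have n1: "n < 1" using close by (simp add: q dist_Pair_Pair dist_real_def n_def)
    have "M * n < c / 2" using close M by (simp add: q dist_Pair_Pair dist_real_def n_def field_simps)
    moreover have "\<bar>x * u + y * v\<bar> \<le> M * n - n"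
      using abs_inner_le[of x u y v] n by (simp add: M_def n_def[symmetric] distrib_right)
    moreover have "n^2 / 4 \<le> n" using n n1 by (simp add: power2_eq_square mult_le_cancel_left1)
    ultimately have "0 < n^2 * (c / 2 - (x * u + y * v) - n^2 / 4)" using n by (intro mult_pos_pos) auto
    also have "\<dots> \<le> V_F a b Fx Fy (x, y) - V_F a b Fx Fy q"
    proof -
      define H where "H = (3*x^2 + y^2 - (1 + 2*a)) * u^2 + 2 * (2*x*y) * u * v + (x^2 + 3*y^2 - (1 - 2*b)) * v^2"
      have "c * n^2 \<le> - H"
        using low[of u v] by (simp only: n2 H_def) (simp add: algebra_simps)
      moreover have "n^2 * (c / 2 - (x * u + y * v) - n^2 / 4) =
          (c * n^2) / 2 - (x * u + y * v) * n^2 - (n^2)^2 / 4"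
        by (simp add: algebra_simps power2_eq_square)
      moreover have "V_F a b Fx Fy q - V_F a b Fx Fy (x, y) = H / 2 + (x * u + y * v) * n^2 + (n^2)^2 / 4"
        unfolding q V_F_expansion[OF crit] n2 H_def ..
      ultimately show ?thesis by linarith
    qed
    finally show ?thesis by simp
  qed
  then show ?thesis
    unfolding hill_def eventually_at using c M by (intro exI[of _ "min 1 (c / (2 * M))"]) auto
qed

text \<open>
  Extremality at a point is refuted along a single ray that starts there; punctured neighbourhoods
  of the point contain the beginning of the ray because the direction is not zero.
\<close>

lemma eventually_along_ray:
  fixes x y u v :: real
  assumes "\<forall>\<^sub>F q in at (x, y). P q" "(u, v) \<noteq> (0, 0)"
  shows "\<forall>\<^sub>F t in at_right 0. P (x + t * u, y + t * v)"
proof -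
  have "filterlim (\<lambda>t. (x + t * u, y + t * v)) (at (x, y)) (at_right 0)"
    unfolding filterlim_at
  proof (rule conjI)
    show "\<forall>\<^sub>F t in at_right 0. (x + t * u, y + t * v) \<in> UNIV \<and> (x + t * u, y + t * v) \<noteq> (x, y)"
      using eventually_at_right_less[of 0] by eventually_elim (use assms(2) in auto)
    have "((\<lambda>t. (x + t * u, y + t * v)) \<longlongrightarrow> (x + 0 * u, y + 0 * v)) (at_right 0)"
      by (intro tendsto_intros)
    then show "((\<lambda>t. (x + t * u, y + t * v)) \<longlongrightarrow> (x, y)) (at_right 0)" by simp
  qed
  with assms(1) show ?thesis by (auto simp: filterlim_iff)
qed

text \<open>
  Along a ray the increment of the potential is \<open>t^2 * (Q/2 + O(t))\<close>, where \<open>Q\<close> is the value of the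
  Hessian form at the direction. The factor \<open>\<sigma>\<close> lets one statement serve ascending and descending
  directions.
\<close>

lemma V_F_ray_sign:
  fixes x y u v :: real
  assumes crit: "critical_point (V_F a b Fx Fy) (x, y)"
    and Q: "Q = (3*x^2 + y^2 - (1 + 2*a)) * u^2 + 2 * (2*x*y) * u * v + (x^2 + 3*y^2 - (1 - 2*b)) * v^2"
    and "\<sigma> * Q > 0"
  shows "\<forall>\<^sub>F t in at_right 0. \<sigma> * (V_F a b Fx Fy (x + t * u, y + t * v) - V_F a b Fx Fy (x, y)) > 0"
proof -
  have "((\<lambda>t. \<sigma> * (Q / 2 + t * ((x * u + y * v) * (u^2 + v^2)) + t^2 * ((u^2 + v^2)^2 / 4))) \<longlongrightarrow>
     \<sigma> * (Q / 2 + 0 * ((x * u + y * v) * (u^2 + v^2)) + 0^2 * ((u^2 + v^2)^2 / 4))) (at_right 0)"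
    by (intro tendsto_intros)
  then have "\<forall>\<^sub>F t in at_right 0.
      0 < \<sigma> * (Q / 2 + t * ((x * u + y * v) * (u^2 + v^2)) + t^2 * ((u^2 + v^2)^2 / 4))"
    by (rule order_tendstoD) (use assms(3) in simp)
  then show ?thesis using eventually_at_right_less[of 0]
  proof eventually_elim
    case (elim t)
    have "\<sigma> * (V_F a b Fx Fy (x + t * u, y + t * v) - V_F a b Fx Fy (x, y)) =
      t^2 * (\<sigma> * (Q / 2 + t * ((x * u + y * v) * (u^2 + v^2)) + t^2 * ((u^2 + v^2)^2 / 4)))"
      unfolding V_F_expansion[OF crit] Q by (simp add: power2_eq_square field_simps)
    also have "\<dots> > 0" using elim by (intro mult_pos_pos[of "t^2"]) auto
    finally show ?case .
  qed
qed

lemma not_local_minimumI: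
  assumes "\<forall>\<^sub>F t in at_right (0::real). f (x + t * u, y + t * v) < f (x, y)" "(u, v) \<noteq> (0, 0)"
  shows "\<not> local_minimum f (x, y)"
proof
  assume "local_minimum f (x, y)"
  from eventually_along_ray[OF this[unfolded local_minimum_def] assms(2)] assms(1)
  have "\<forall>\<^sub>F t in at_right (0::real). False" by eventually_elim auto
  then show False by simp
qed

lemma not_local_maximumI:
  assumes "\<forall>\<^sub>F t in at_right (0::real). f (x, y) < f (x + t * u, y + t * v)" "(u, v) \<noteq> (0, 0)"
  shows "\<not> local_maximum f (x, y)"
proof
  assume "local_maximum f (x, y)"
  from eventually_along_ray[OF this[unfolded local_maximum_def] assms(2)] assms(1)
  have "\<forall>\<^sub>F t in at_right (0::real). False" by eventually_elim auto
  then show False by simp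
qed

lemma indefinite_form_takes_sign:
  fixes p q s \<sigma> :: real
  assumes "p * q < s^2" "\<sigma> \<noteq> 0"
  obtains u v where "(u, v) \<noteq> (0, 0)" "\<sigma> * (p * u^2 + 2 * s * u * v + q * v^2) > 0"
proof (cases "\<sigma> * p" "0 :: real" rule: linorder_cases)
  case greater
  then show ?thesis by (intro that[of 1 0]) auto
next
  case less
  \<comment> \<open>the vector \<open>(-s, p)\<close> is orthogonal to \<open>(1, 0)\<close> with respect to the form\<close>
  have "\<sigma> * (p * (-s)^2 + 2 * s * (-s) * p + q * p^2) = (\<sigma> * p) * (p * q - s^2)"
    by (simp add: algebra_simps power2_eq_square)
  also have "\<dots> > 0" using less assms by (intro mult_neg_neg) auto
  finally show ?thesis using less by (intro that[of "-s" p]) auto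
next
  case equal
  then have p: "p = 0" and s: "s \<noteq> 0" using assms by auto
  \<comment> \<open>the form is affine in \<open>u\<close> on the line \<open>v = 1\<close>; this \<open>u\<close> makes its value equal to \<open>\<sigma>\<close>\<close>
  define u where "u = (\<sigma> - q) / (2 * s)"
  have "2 * s * u = \<sigma> - q" using s by (simp add: u_def)
  then have "\<sigma> * (p * u^2 + 2 * s * u * 1 + q * 1^2) = \<sigma>^2" by (simp add: p power2_eq_square)
  moreover have "\<sigma>^2 > 0" using assms(2) by simp
  ultimately show ?thesis by (intro that[of u 1]) auto
qed

lemma V_F_saddle:
  assumes crit: "critical_point (V_F a b Fx Fy) (x, y)"
    and det: "(3*x^2 + y^2 - (1 + 2*a)) * (x^2 + 3*y^2 - (1 - 2*b)) < (2*x*y)^2"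
  shows "saddle (V_F a b Fx Fy) (x, y)"
  unfolding saddle_def
proof (intro conjI)
  show "critical_point (V_F a b Fx Fy) (x, y)" by fact
  obtain u v where "(u, v) \<noteq> (0, 0)"
    "- 1 * ((3*x^2 + y^2 - (1 + 2*a)) * u^2 + 2 * (2*x*y) * u * v + (x^2 + 3*y^2 - (1 - 2*b)) * v^2) > 0"
    using indefinite_form_takes_sign[OF det, of "-1"] by auto
  from V_F_ray_sign[OF crit refl this(2)] this(1)
  show "\<not> local_minimum (V_F a b Fx Fy) (x, y)" by (intro not_local_minimumI) auto
  obtain u v where "(u, v) \<noteq> (0, 0)"
    "1 * ((3*x^2 + y^2 - (1 + 2*a)) * u^2 + 2 * (2*x*y) * u * v + (x^2 + 3*y^2 - (1 - 2*b)) * v^2) > 0"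
    using indefinite_form_takes_sign[OF det, of 1] by auto
  from V_F_ray_sign[OF crit refl this(2)] this(1)
  show "\<not> local_maximum (V_F a b Fx Fy) (x, y)" by (intro not_local_maximumI) auto
qed

section \<open>The trigonometric roots of a depressed cubic\<close>

text \<open>
  If \<open>cos \<phi>\<close> is the quotient of \<open>F\<close> and the critical force, then the argument of the arctangent in the
  formula is \<open>tan \<phi>\<close>. The angle is complex, so that forces below the critical one (real \<open>\<phi>\<close>) and above
  it (imaginary \<open>\<phi>\<close>) are treated alike; the condition on \<open>sin \<phi>\<close> says that \<open>sin \<phi>\<close> is the principal
  square root of its square.
\<close>

lemma trig_root_eq_cos:
  assumes "c > 0" "F > 0"
    and strip: "\<bar>Re \<phi>\<bar> < pi / 2"
    and cos: "cos \<phi> = complex_of_real (F * sqrt 27 / (2 * sqrt c ^ 3))"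
    and sin: "0 < Re (sin \<phi>) \<or> Re (sin \<phi>) = 0 \<and> 0 \<le> Im (sin \<phi>)"
  shows "trig_root c F k =
    - complex_of_real (2 / sqrt 3 * sqrt c) * cos (\<phi> / 3 + complex_of_real (2 * pi / 3 * real k))"
proof -
  \<comment> \<open>\<open>K / sqrt 27\<close> is the critical force \<open>sqrt (4 * c^3 / 27)\<close>\<close>
  define K where "K = 2 * sqrt c ^ 3"
  have K: "K > 0" using assms(1) by (simp add: K_def)
  have K2: "K^2 = 4 * c^3"
    using assms(1) by (simp add: K_def power_mult_distrib power2_eq_square power3_eq_cube)
  have Kcos: "complex_of_real (F * sqrt 27) = of_real K * cos \<phi>"
    unfolding cos K_def[symmetric] using K by simp
  have "complex_of_real (4 * c^3 - 27 * F^2) = of_real (K^2) - (complex_of_real (F * sqrt 27))^2"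
    unfolding K2 by (simp add: power_mult_distrib flip: of_real_power)
  also have "\<dots> = (of_real K * sin \<phi>)^2"
    unfolding Kcos by (simp add: power_mult_distrib cos_squared_eq algebra_simps)
  finally have "csqrt (complex_of_real (4 * c^3 - 27 * F^2)) = of_real K * sin \<phi>"
    by (simp only:) (rule csqrt_square, use K sin in \<open>auto simp: zero_less_mult_iff\<close>)
  then have "csqrt (complex_of_real (4 * c^3 - 27 * F^2)) / complex_of_real (F * sqrt 27) = tan \<phi>"
    using K by (simp only: Kcos) (simp add: tan_def)
  then show ?thesis
    unfolding trig_root_def using Arctan_tan[OF strip] by simp
qed

text \<open>
  This is the triple-angle formula: multiplying the angle by \<open>3\<close> gives \<open>\<phi>\<close> up to a multiple of \<open>2*pi\<close>,
  so all three choices of \<open>k\<close> lead to the same right-hand side \<open>cos \<phi>\<close>.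
\<close>

lemma trig_root_cubic:
  assumes "c > 0"
    and cos: "cos \<phi> = complex_of_real (F * sqrt 27 / (2 * sqrt c ^ 3))"
    and t: "t = - complex_of_real (2 / sqrt 3 * sqrt c) * cos (\<phi> / 3 + complex_of_real (2 * pi / 3 * real k))"
  shows "t^3 - of_real c * t + of_real F = 0"
proof -
  define m where "m = sqrt (c / 3)"
  define w where "w = cos (\<phi> / 3 + complex_of_real (2 * pi / 3 * real k))"
  have m: "m > 0" "c = 3 * m^2" using assms(1) by (auto simp: m_def)
  have "3 * (\<phi> / 3 + complex_of_real (2 * pi / 3 * real k)) = \<phi> + of_real (2 * pi * real k)"
    by (simp add: field_simps)
  then have "4 * w^3 - 3 * w = cos (\<phi> + of_real (2 * pi * real k))"
    unfolding w_def by (simp only: flip: cos_treble_cos)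
  also have "\<dots> = cos \<phi>"
    using cos_2npi[of k] sin_2npi[of k]
    by (simp only: cos_add cos_of_real sin_of_real) (simp add: mult_ac)
  also have "\<dots> = of_real (F / (2 * m^3))"
  proof -
    have "sqrt 27 = 3 * sqrt 3" by (rule real_sqrt_unique) (simp_all add: power_mult_distrib)
    then have "sqrt 27 = sqrt 3 ^ 3" by (simp add: power3_eq_cube)
    then show ?thesis unfolding cos m_def by (simp add: real_sqrt_divide power_divide)
  qed
  finally have "2 * of_real m ^ 3 * (4 * w^3 - 3 * w) = of_real F"
    using m by simp
  moreover have "t = - 2 * of_real m * w"
    unfolding t w_def m_def by (simp add: real_sqrt_divide)
  ultimately show ?thesis
    using m(2) by (simp add: power_mult_distrib algebra_simps power2_eq_square power3_eq_cube)
qed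

lemma cubic_other_roots:
  fixes c F s t :: real
  assumes "s^3 - c * s + F = 0"
  shows "t^3 - c * t + F = 0 \<longleftrightarrow> t = s \<or> t^2 + s * t + s^2 - c = 0"
proof -
  have "t^3 - c * t + F = (t - s) * (t^2 + s * t + s^2 - c)"
    using assms by (simp add: algebra_simps power2_eq_square power3_eq_cube)
  then show ?thesis by simp
qed

text \<open>
  The discriminant of the quadratic cofactor of the root \<open>t\<close> is \<open>4*c - 3*t^2\<close>.
\<close>

lemma cubic_unique_root:
  fixes c F t u :: real
  assumes "4 * c < 3 * t^2" "t^3 - c * t + F = 0"
  shows "u^3 - c * u + F = 0 \<longleftrightarrow> u = t"
proof -
  have "0 < (2 * u + t)^2 + (3 * t^2 - 4 * c)" using assms(1) by (intro add_nonneg_pos) auto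
  also have "\<dots> = 4 * (u^2 + t * u + t^2 - c)" by (simp add: power2_eq_square algebra_simps)
  finally show ?thesis using cubic_other_roots[OF assms(2), of u] by auto
qed

lemma cubic_factorization:
  fixes c F t\<^sub>0 t\<^sub>1 :: real
  assumes "t\<^sub>0^3 - c * t\<^sub>0 + F = 0" "t\<^sub>1^3 - c * t\<^sub>1 + F = 0" "t\<^sub>2^3 - c * t\<^sub>2 + F = 0"
    and "t\<^sub>0 \<noteq> t\<^sub>1" "t\<^sub>0 \<noteq> t\<^sub>2" "t\<^sub>1 \<noteq> t\<^sub>2"
  shows "t^3 - c * t + F = (t - t\<^sub>0) * (t - t\<^sub>1) * (t - t\<^sub>2)"
proof -
  have q: "t\<^sub>1^2 + t\<^sub>0 * t\<^sub>1 + t\<^sub>0^2 - c = 0" "t\<^sub>2^2 + t\<^sub>0 * t\<^sub>2 + t\<^sub>0^2 - c = 0"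
    using assms cubic_other_roots[OF assms(1)] by auto
  \<comment> \<open>the roots of a cubic without quadratic term have sum \<open>0\<close>\<close>
  have "(t\<^sub>1 - t\<^sub>2) * (t\<^sub>0 + t\<^sub>1 + t\<^sub>2) = 0"
    using q by (simp add: algebra_simps power2_eq_square)
  then have t0: "t\<^sub>0 = - t\<^sub>1 - t\<^sub>2" using assms by auto
  then have c: "c = t\<^sub>1^2 + t\<^sub>1 * t\<^sub>2 + t\<^sub>2^2"
    using q(1) unfolding t0 by (simp add: algebra_simps power2_eq_square)
  have "F = c * t\<^sub>1 - t\<^sub>1^3" using assms(2) by simp
  then show ?thesis
    unfolding t0 c by (simp add: algebra_simps power2_eq_square power3_eq_cube)
qed

text \<open>
  The quotient on the right is the cosine of the angle \<open>\<phi>\<close> that the formula for the roots divides by \<open>3\<close>.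
\<close>

lemma compare_crit_iff:
  fixes c F :: real
  assumes "c > 0" "F \<ge> 0"
  shows "F < sqrt (4 * c^3 / 27) \<longleftrightarrow> F * sqrt 27 / (2 * sqrt c ^ 3) < 1"
    and "F = sqrt (4 * c^3 / 27) \<longleftrightarrow> F * sqrt 27 / (2 * sqrt c ^ 3) = 1"
    and "F > sqrt (4 * c^3 / 27) \<longleftrightarrow> F * sqrt 27 / (2 * sqrt c ^ 3) > 1"
proof -
  have "sqrt (4 * c^3 / 27) = 2 * sqrt c ^ 3 / sqrt 27"
    by (simp add: real_sqrt_divide real_sqrt_mult real_sqrt_power)
  then have *: "sqrt (4 * c^3 / 27) * sqrt 27 = 2 * sqrt c ^ 3" by simp
  have "F < sqrt (4 * c^3 / 27) \<longleftrightarrow> F * sqrt 27 < 2 * sqrt c ^ 3"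
    "F = sqrt (4 * c^3 / 27) \<longleftrightarrow> F * sqrt 27 = 2 * sqrt c ^ 3"
    "F > sqrt (4 * c^3 / 27) \<longleftrightarrow> F * sqrt 27 > 2 * sqrt c ^ 3"
    unfolding *[symmetric] by simp_all
  then show "F < sqrt (4 * c^3 / 27) \<longleftrightarrow> F * sqrt 27 / (2 * sqrt c ^ 3) < 1"
    "F = sqrt (4 * c^3 / 27) \<longleftrightarrow> F * sqrt 27 / (2 * sqrt c ^ 3) = 1"
    "F > sqrt (4 * c^3 / 27) \<longleftrightarrow> F * sqrt 27 / (2 * sqrt c ^ 3) > 1"
    using assms(1) by (auto simp: pos_divide_less_eq pos_less_divide_eq)
qed

text \<open>
  Here \<open>\<phi>\<close> is a real angle \<open>\<theta>\<close> strictly between \<open>0\<close> and \<open>pi/2\<close>. The three angles in the formula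
  then lie between \<open>0\<close> and \<open>pi/6\<close>, between \<open>2*pi/3\<close> and \<open>5*pi/6\<close>, and between \<open>4*pi/3\<close> and \<open>3*pi/2\<close>,
  and monotonicity of the cosine separates the roots from each other and from the turning point
  \<open>sqrt (c/3)\<close> of the cubic.
\<close>

lemma trig_roots_below_crit:
  assumes "c > 0" "F > 0" "F < sqrt (4 * c^3 / 27)"
  obtains t\<^sub>0 t\<^sub>1 t\<^sub>2 :: real where
    "trig_root c F 0 = of_real t\<^sub>0" "trig_root c F 1 = of_real t\<^sub>1" "trig_root c F 2 = of_real t\<^sub>2"
    "t\<^sub>0 < 0" "0 < t\<^sub>2" "t\<^sub>2 < sqrt (c / 3)" "sqrt (c / 3) < t\<^sub>1"
    "\<And>t. t^3 - c * t + F = (t - t\<^sub>0) * (t - t\<^sub>1) * (t - t\<^sub>2)"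
proof -
  define \<theta> where "\<theta> = arccos (F * sqrt 27 / (2 * sqrt c ^ 3))"
  have w: "0 < F * sqrt 27 / (2 * sqrt c ^ 3)" "F * sqrt 27 / (2 * sqrt c ^ 3) < 1"
    using assms compare_crit_iff[of c F] by auto
  have cos\<theta>: "cos \<theta> = F * sqrt 27 / (2 * sqrt c ^ 3)" using w by (simp add: \<theta>_def)
  have \<theta>: "0 < \<theta>" "\<theta> < pi / 2"
    using w arccos_less_arccos[of 0 "F * sqrt 27 / (2 * sqrt c ^ 3)"]
      arccos_less_arccos[of "F * sqrt 27 / (2 * sqrt c ^ 3)" 1] by (auto simp: \<theta>_def)
  have ccos: "cos (complex_of_real \<theta>) = complex_of_real (F * sqrt 27 / (2 * sqrt c ^ 3))"
    by (simp only: cos_of_real cos\<theta>)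
  define t where "t k = - (2 * sqrt (c / 3)) * cos (\<theta> / 3 + 2 * pi / 3 * real k)" for k
  have tc: "complex_of_real (t k) = - complex_of_real (2 / sqrt 3 * sqrt c) *
       cos (complex_of_real \<theta> / 3 + complex_of_real (2 * pi / 3 * real k))" for k
  proof -
    have "complex_of_real \<theta> / 3 + complex_of_real (2 * pi / 3 * real k) =
        complex_of_real (\<theta> / 3 + 2 * pi / 3 * real k)" by simp
    then show ?thesis
      by (simp only: cos_of_real t_def) (simp add: real_sqrt_divide)
  qed
  have root: "trig_root c F k = of_real (t k)" for k
    unfolding tc using \<theta> sin_gt_zero[of \<theta>] by (intro trig_root_eq_cos assms ccos) (auto simp: sin_of_real)
  have cubic: "t k ^ 3 - c * t k + F = 0" for k
  proof -
    have "complex_of_real (t k ^ 3 - c * t k + F) = 0"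
      using trig_root_cubic[OF assms(1) ccos tc[of k]] by simp
    then show ?thesis by (simp only: of_real_eq_0_iff)
  qed
  define m where "m = sqrt (c / 3)"
  have m: "m > 0" using assms(1) by (simp add: m_def)
  have "cos (\<theta> / 3) > 0" using \<theta> by (intro cos_gt_zero_pi) auto
  then have t0: "t 0 < 0" using m by (simp add: t_def m_def[symmetric])
  have "cos (\<theta> / 3 + 2 * pi / 3) < cos (2 * pi / 3)"
    using \<theta> by (intro cos_monotone_0_pi) auto
  from mult_strict_left_mono[OF this m]
  have t1: "t 1 > m" by (simp add: t_def m_def[symmetric] cos_120)
  have "cos (\<theta> / 3 + 4 * pi / 3) = - cos (\<theta> / 3 + pi / 3)"
    using cos_periodic_pi[of "\<theta> / 3 + pi / 3"] by (simp add: algebra_simps)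
  then have t2_eq: "t 2 = 2 * m * cos (\<theta> / 3 + pi / 3)" by (simp add: t_def m_def[symmetric])
  have "cos (\<theta> / 3 + pi / 3) < cos (pi / 3)"
    using \<theta> by (intro cos_monotone_0_pi) auto
  moreover have "0 < cos (\<theta> / 3 + pi / 3)"
    using \<theta> by (intro cos_gt_zero_pi) auto
  ultimately have t2: "0 < t 2" "t 2 < m" using m by (simp_all add: t2_eq cos_60)
  show ?thesis
    using t0 t1 t2 cubic_factorization[OF cubic[of 0] cubic[of 1] cubic[of 2]]
    by (intro that[of "t 0" "t 1" "t 2"] root) (auto simp: m_def)
qed

text \<open>
  Here \<open>\<phi> = 0\<close>: the roots for \<open>k = 1\<close> and \<open>k = 2\<close> merge at the turning point of the cubic.
\<close>

lemma trig_roots_at_crit: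
  assumes "c > 0" "F > 0" "F = sqrt (4 * c^3 / 27)"
  shows "trig_root c F 0 = of_real (- 2 * sqrt (c / 3))"
    and "trig_root c F 1 = of_real (sqrt (c / 3))"
    and "trig_root c F 2 = of_real (sqrt (c / 3))"
    and "t^3 - c * t + F = 0 \<longleftrightarrow> t = - 2 * sqrt (c / 3) \<or> t = sqrt (c / 3)"
proof -
  define m where "m = sqrt (c / 3)"
  have m: "m > 0" "c = 3 * m^2" using assms(1) by (auto simp: m_def)
  have w: "F * sqrt 27 / (2 * sqrt c ^ 3) = 1"
    using assms compare_crit_iff[of c F] by auto
  have root: "trig_root c F k = of_real (- 2 * m * cos (2 * pi / 3 * real k))" for k
  proof -
    have "trig_root c F k =
      - complex_of_real (2 / sqrt 3 * sqrt c) * cos (0 / 3 + complex_of_real (2 * pi / 3 * real k))"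
      using assms w by (intro trig_root_eq_cos) auto
    also have "\<dots> = of_real (- 2 * m * cos (2 * pi / 3 * real k))"
      by (simp only: div_0 add_0_left cos_of_real) (simp add: m_def real_sqrt_divide)
    finally show ?thesis .
  qed
  have "cos (4 * pi / 3) = - cos (pi / 3)"
    using cos_periodic_pi[of "pi / 3"] by (simp add: algebra_simps)
  then show "trig_root c F 0 = of_real (- 2 * sqrt (c / 3))"
    "trig_root c F 1 = of_real (sqrt (c / 3))" "trig_root c F 2 = of_real (sqrt (c / 3))"
    unfolding root m_def[symmetric] by (simp_all add: cos_120 cos_60)
  have "F = sqrt ((2 * m^3)^2)"
    unfolding assms(3) m(2) by (simp add: power_mult_distrib power2_eq_square power3_eq_cube)
  then have F: "F = 2 * m^3" using m by (simp only: real_sqrt_abs) simp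
  have "t^3 - c * t + F = (t + 2 * m) * (t - m)^2"
    unfolding F m(2) by (simp add: algebra_simps power2_eq_square power3_eq_cube)
  then show "t^3 - c * t + F = 0 \<longleftrightarrow> t = - 2 * sqrt (c / 3) \<or> t = sqrt (c / 3)"
    unfolding m_def[symmetric] by auto
qed

text \<open>
  Here \<open>\<phi> = \<i> * \<eta>\<close> with \<open>\<eta> > 0\<close>. The cosine of \<open>\<i> * \<eta>/3 + \<alpha>\<close> has imaginary part \<open>- sinh (\<eta>/3) * sin \<alpha>\<close>,
  which vanishes for \<open>k = 0\<close> and for neither of the other two angles.
\<close>

lemma trig_roots_above_crit:
  assumes "c > 0" "F > 0" "F > sqrt (4 * c^3 / 27)"
  obtains t\<^sub>0 :: real where
    "trig_root c F 0 = of_real t\<^sub>0" "trig_root c F 1 \<notin> \<real>" "trig_root c F 2 \<notin> \<real>"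
    "t\<^sub>0 < 0" "\<And>t. t^3 - c * t + F = 0 \<longleftrightarrow> t = t\<^sub>0"
proof -
  define w where "w = F * sqrt 27 / (2 * sqrt c ^ 3)"
  define \<eta> where "\<eta> = arcosh w"
  have w: "w > 1" using assms compare_crit_iff[of c F] by (auto simp: w_def)
  have \<eta>: "\<eta> > 0" "cosh \<eta> = w" using w by (auto simp: \<eta>_def)
  have cos_i: "cos (\<i> * complex_of_real u) = of_real (cosh u)"
    and sin_i: "sin (\<i> * complex_of_real u) = \<i> * of_real (sinh u)" for u
    by (simp_all only: cos_i_times sin_i_times)
      (simp_all add: cosh_field_def sinh_field_def exp_minus exp_of_real)
  have ccos: "cos (\<i> * complex_of_real \<eta>) = complex_of_real (F * sqrt 27 / (2 * sqrt c ^ 3))"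
    by (simp only: cos_i \<eta> w_def)
  define m where "m = sqrt (c / 3)"
  have m: "m > 0" "c = 3 * m^2" using assms(1) by (auto simp: m_def)
  have root: "trig_root c F k = - complex_of_real (2 / sqrt 3 * sqrt c) *
      cos (\<i> * complex_of_real \<eta> / 3 + complex_of_real (2 * pi / 3 * real k))" for k
    using \<eta> by (intro trig_root_eq_cos assms ccos) (auto simp: sin_i)
  have cs: "cos (\<i> * complex_of_real \<eta> / 3 + complex_of_real \<alpha>) =
     of_real (cosh (\<eta> / 3) * cos \<alpha>) - \<i> * of_real (sinh (\<eta> / 3) * sin \<alpha>)" for \<alpha>
    using cos_i[of "\<eta> / 3"] sin_i[of "\<eta> / 3"] by (simp add: cos_add cos_of_real sin_of_real)
  define t where "t = - 2 * m * cosh (\<eta> / 3)"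
  have root0: "trig_root c F 0 = of_real t"
    using cs[of 0] unfolding root by (simp add: t_def m_def real_sqrt_divide)
  have cubic: "t^3 - c * t + F = 0"
  proof -
    have "complex_of_real (t^3 - c * t + F) = 0"
      using trig_root_cubic[OF assms(1) ccos root[of 0, unfolded root0]] by simp
    then show ?thesis by (simp only: of_real_eq_0_iff)
  qed
  have nonreal: "trig_root c F k \<notin> \<real>" if "sin (2 * pi / 3 * real k) \<noteq> 0" for k
  proof -
    have "Im (trig_root c F k) = 2 * m * (sinh (\<eta> / 3) * sin (2 * pi / 3 * real k))"
      unfolding root cs by (simp add: m_def real_sqrt_divide)
    then show ?thesis using that m \<eta> by (auto simp: complex_is_Real_iff)
  qed
  have "sin (4 * pi / 3) = - sin (pi / 3)"
    using sin_periodic_pi[of "pi / 3"] by (simp add: algebra_simps)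
  then have nr: "trig_root c F 1 \<notin> \<real>" "trig_root c F 2 \<notin> \<real>"
    by (auto intro!: nonreal simp: sin_120 sin_60)
  have "cosh (\<eta> / 3) > 1" using \<eta> cosh_real_strict_mono[of 0 "\<eta> / 3"] by simp
  then have t: "t < - 2 * m" using m by (simp add: t_def)
  then have "(2 * m)^2 < (- t)^2" using m by (intro power_strict_mono) auto
  then have "4 * c < 3 * t^2" by (simp add: m(2) power_mult_distrib)
  then have uniq: "u^3 - c * u + F = 0 \<longleftrightarrow> u = t" for u
    by (rule cubic_unique_root[OF _ cubic])
  from t m have "t < 0" by linarith
  with root0 nr uniq show ?thesis by (intro that)
qed

section \<open>Critical points on and off the coordinate axes\<close>

lemma well_x_axis:
  assumes "critical_point (V_F a b Fx Fy) (x, 0)" "x^2 > (1 + 2*a) / 3" "x^2 > 1 - 2*b"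
  shows "well (V_F a b Fx Fy) (x, 0)"
  using assms by (intro V_F_well) auto

lemma hill_x_axis:
  assumes "critical_point (V_F a b Fx Fy) (x, 0)" "x^2 < (1 + 2*a) / 3" "x^2 < 1 - 2*b"
  shows "hill (V_F a b Fx Fy) (x, 0)"
  using assms by (intro V_F_hill) (auto intro: mult_neg_neg)

lemma saddle_x_axis:
  assumes "critical_point (V_F a b Fx Fy) (x, 0)"
    and "x^2 < (1 + 2*a) / 3 \<and> x^2 > 1 - 2*b \<or> x^2 > (1 + 2*a) / 3 \<and> x^2 < 1 - 2*b"
  shows "saddle (V_F a b Fx Fy) (x, 0)"
  using assms by (intro V_F_saddle) (auto intro: mult_neg_pos mult_pos_neg)

lemma well_y_axis:
  assumes "critical_point (V_F a b Fx Fy) (0, y)" "y^2 > 1 + 2*a" "y^2 > (1 - 2*b) / 3"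
  shows "well (V_F a b Fx Fy) (0, y)"
  using assms by (intro V_F_well) auto

lemma hill_y_axis:
  assumes "critical_point (V_F a b Fx Fy) (0, y)" "y^2 < 1 + 2*a" "y^2 < (1 - 2*b) / 3"
  shows "hill (V_F a b Fx Fy) (0, y)"
  using assms by (intro V_F_hill) (auto intro: mult_neg_neg)

lemma saddle_y_axis:
  assumes "critical_point (V_F a b Fx Fy) (0, y)" "y^2 < 1 + 2*a" "y^2 > (1 - 2*b) / 3"
  shows "saddle (V_F a b Fx Fy) (0, y)"
  using assms by (intro V_F_saddle) (auto intro: mult_neg_pos)

text \<open>
  On the circle \<open>x^2 + y^2 = 1 - 2*b\<close>, which carries the critical points off the x-axis, the
  determinant of the Hessian is \<open>- 4*(a + b)*y^2\<close>.
\<close>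

lemma saddle_off_x_axis:
  assumes crit: "critical_point (V_F a b Fx Fy) (x, y)" and "a + b > 0"
    and "y \<noteq> 0" and r: "x^2 + y^2 = 1 - 2*b"
  shows "saddle (V_F a b Fx Fy) (x, y)"
proof (rule V_F_saddle[OF crit])
  have pq: "3*x^2 + y^2 - (1 + 2*a) = 2*x^2 - 2*(a + b)" "x^2 + 3*y^2 - (1 - 2*b) = 2*y^2"
    using r by (simp_all add: algebra_simps)
  have "(a + b) * y^2 > 0" using assms by simp
  then show "(3*x^2 + y^2 - (1 + 2*a)) * (x^2 + 3*y^2 - (1 - 2*b)) < (2*x*y)^2"
    unfolding pq by (simp add: algebra_simps)
qed

text \<open>
  On the circle \<open>x^2 + y^2 = 1 + 2*a\<close> the determinant of the Hessian is \<open>4*(a + b)*x^2\<close>.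
\<close>

lemma well_off_y_axis:
  assumes crit: "critical_point (V_F a b Fx Fy) (x, y)" and "a + b > 0"
    and "x \<noteq> 0" and r: "x^2 + y^2 = 1 + 2*a"
  shows "well (V_F a b Fx Fy) (x, y)"
proof (rule V_F_well[OF crit])
  have pq: "3*x^2 + y^2 - (1 + 2*a) = 2*x^2" "x^2 + 3*y^2 - (1 - 2*b) = 2*y^2 + 2*(a + b)"
    using r by (simp_all add: algebra_simps)
  show "3*x^2 + y^2 - (1 + 2*a) > 0" unfolding pq using \<open>x \<noteq> 0\<close> by simp
  have "(a + b) * x^2 > 0" using assms by simp
  then show "(3*x^2 + y^2 - (1 + 2*a)) * (x^2 + 3*y^2 - (1 - 2*b)) > (2*x*y)^2"
    unfolding pq by (simp add: algebra_simps)
qed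

text \<open>
  The y-component of the gradient is \<open>y * (x^2 + y^2 - (1 - 2*b))\<close>, so a critical point lies on the
  axis, where the x-component is a cubic, or on the circle, where it becomes linear in \<open>x\<close>.
\<close>

lemma critical_point_Fy_0_iff:
  assumes "a + b > 0"
  shows "critical_point (V_F a b Fx 0) (x, y) \<longleftrightarrow>
     y = 0 \<and> x^3 - (1 + 2*a) * x + Fx = 0 \<or>
     y \<noteq> 0 \<and> x = Fx / (2 * (a + b)) \<and> x^2 + y^2 = 1 - 2*b"
proof (cases "y = 0")
  case True
  then show ?thesis by (simp add: critical_point_V_F_iff power2_eq_square power3_eq_cube mult.assoc)
next
  case False
  have "y * (x^2 + y^2) - (1 - 2*b) * y = y * (x^2 + y^2 - (1 - 2*b))" by (simp add: algebra_simps)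
  then have "y * (x^2 + y^2) - (1 - 2*b) * y + 0 = 0 \<longleftrightarrow> x^2 + y^2 = 1 - 2*b" using False by simp
  moreover have "x * (x^2 + y^2) - (1 + 2*a) * x + Fx = 0 \<longleftrightarrow> x = Fx / (2 * (a + b))"
    if r: "x^2 + y^2 = 1 - 2*b"
  proof -
    have "x * (x^2 + y^2) - (1 + 2*a) * x = - (x * (2 * (a + b)))" unfolding r by (simp add: algebra_simps)
    then show ?thesis using assms by (auto simp: eq_divide_eq)
  qed
  ultimately show ?thesis using False by (auto simp: critical_point_V_F_iff)
qed

lemma critical_point_Fx_0_iff:
  assumes "a + b > 0"
  shows "critical_point (V_F a b 0 Fy) (x, y) \<longleftrightarrow>
     x = 0 \<and> y^3 - (1 - 2*b) * y + Fy = 0 \<or>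
     x \<noteq> 0 \<and> y = - Fy / (2 * (a + b)) \<and> x^2 + y^2 = 1 + 2*a"
proof (cases "x = 0")
  case True
  then show ?thesis by (simp add: critical_point_V_F_iff power2_eq_square power3_eq_cube mult.assoc)
next
  case False
  have "x * (x^2 + y^2) - (1 + 2*a) * x = x * (x^2 + y^2 - (1 + 2*a))" by (simp add: algebra_simps)
  then have "x * (x^2 + y^2) - (1 + 2*a) * x + 0 = 0 \<longleftrightarrow> x^2 + y^2 = 1 + 2*a" using False by simp
  moreover have "y * (x^2 + y^2) - (1 - 2*b) * y + Fy = 0 \<longleftrightarrow> y = - Fy / (2 * (a + b))"
    if r: "x^2 + y^2 = 1 + 2*a"
  proof -
    have "y * (x^2 + y^2) - (1 - 2*b) * y = y * (2 * (a + b))" unfolding r by (simp add: algebra_simps)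
    then have "y * (x^2 + y^2) - (1 - 2*b) * y + Fy = 0 \<longleftrightarrow> y * (2 * (a + b)) = - Fy" by linarith
    then show ?thesis using assms by (simp only: eq_divide_eq) simp
  qed
  ultimately show ?thesis using False by (auto simp: critical_point_V_F_iff)
qed

section \<open>Tables of complex formulas and real points\<close>

lemma real_point_eq_iff [simp]: "real_point p = real_point q \<longleftrightarrow> p = q"
  by (auto simp: real_point_def split: prod.splits)

lemma mem_range_real_point_iff: "(z, w) \<in> range real_point \<longleftrightarrow> z \<in> \<real> \<and> w \<in> \<real>"
  by (force simp: real_point_def elim!: Reals_cases)

lemma has_nature_real_point [simp]:
  "has_nature V (real_point p) Well \<longleftrightarrow> well V p"
  "has_nature V (real_point p) Hill \<longleftrightarrow> hill V p"
  "has_nature V (real_point p) Saddle \<longleftrightarrow> saddle V p"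
  "has_nature V (real_point p) Unidentified \<longleftrightarrow> critical_point V p"
  by auto

text \<open>
  Once every existing entry is written as the image of a real point, only statements about real
  points remain. Entries without a real point may stand on both sides of the existing ones, because
  the tables for a force along the x-axis list them last and those for the y-axis may list them
  first as well as last.
\<close>

lemma critical_tableI:
  fixes E :: "((real \<times> real) \<times> nature) list"
  assumes N: "\<forall>(z, n) \<in> set N \<union> set N'. n = Nonexistent \<and> z \<notin> range real_point"
    and E: "\<forall>(p, n) \<in> set E. n \<noteq> Nonexistent \<and> has_nature V (real_point p) n"
    and all: "\<And>x y. critical_point V (x, y) \<longleftrightarrow> (x, y) \<in> fst ` set E"
    and distinct: "sorted_wrt (\<lambda>s t. fst s = fst t \<longrightarrow> snd s = Unidentified \<and> snd t = Unidentified) E"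
  shows "critical_table V (N @ map (map_prod real_point id) E @ N')"
  (is "critical_table V ?T")
proof -
  have nature: "\<forall>(z, n) \<in> set ?T. has_nature V z n"
  proof safe
    fix z n assume "(z, n) \<in> set ?T"
    then consider "(z, n) \<in> set N \<union> set N'" | p where "z = real_point p" "(p, n) \<in> set E" by auto
    then show "has_nature V z n"
    proof cases
      case 1
      with N have "n = Nonexistent" "z \<notin> range real_point" by blast+
      then show ?thesis by simp
    next
      case 2
      with E show ?thesis by blast
    qed
  qed
  have points: "real_point ` {p. critical_point V p} = {z. \<exists>n. (z, n) \<in> set ?T \<and> n \<noteq> Nonexistent}"
  proof -
    have "{z. \<exists>n. (z, n) \<in> set ?T \<and> n \<noteq> Nonexistent} = real_point ` fst ` set E"
      using N E by force
    moreover have "{p. critical_point V p} = fst ` set E" using all by auto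
    ultimately show ?thesis by simp
  qed
  define R where "R = (\<lambda>s t :: (complex \<times> complex) \<times> nature.
    fst s = fst t \<and> snd s \<noteq> Nonexistent \<and> snd t \<noteq> Nonexistent \<longrightarrow>
    snd s = Unidentified \<and> snd t = Unidentified)"
  have "sorted_wrt R (map (map_prod real_point id) E)"
    unfolding sorted_wrt_map by (rule sorted_wrt_mono_rel[OF _ distinct]) (auto simp: R_def)
  moreover have "sorted_wrt R M" if "\<forall>(z, n) \<in> set M. n = Nonexistent" for M
    using that by (induction M) (auto simp: R_def)
  ultimately have sorted: "sorted_wrt R ?T"
    using N by (auto simp: sorted_wrt_append R_def)
  have "R (?T ! i) (?T ! j)" if "i < length ?T" "j < length ?T" "i \<noteq> j" for i j
    using sorted_wrt_nth_less[OF sorted, of i j] sorted_wrt_nth_less[OF sorted, of j i] that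
    by (cases i j rule: linorder_cases) (auto simp: R_def)
  then show ?thesis
    using nature points unfolding critical_table_def R_def by blast
qed

lemma csqrt_of_neg_real:
  assumes "s < 0"
  shows "csqrt (complex_of_real s) \<notin> \<real>"
  using assms by (auto simp: csqrt_of_real' complex_is_Real_iff)

section \<open>Force along the x-axis\<close>

text \<open>
  With \<open>m = sqrt ((1 + 2*a)/3)\<close> and \<open>s = sqrt (1 - 2*b)\<close>, the saddle force is the value at \<open>s\<close> of
  \<open>3*m^2*t - t^3\<close>, and the critical force is the maximum of this function over \<open>t \<ge> 0\<close>, attained at \<open>m\<close>.
\<close>

lemma Fx_sad_le_Fx_crit:
  assumes "a > 0" "b < 1/2"
  shows "Fx_sad a b \<le> Fx_crit a"
proof -
  define m s where "m = sqrt ((1 + 2*a) / 3)" and "s = sqrt (1 - 2*b)"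
  have m: "m > 0" "1 + 2*a = 3 * m^2" and s: "s > 0" "1 - 2*b = s^2"
    using assms by (auto simp: m_def s_def)
  have "Fx_crit a = sqrt ((2 * m^3)^2)"
    unfolding Fx_crit_def m(2) by (simp add: power_mult_distrib flip: power_mult)
  then have crit: "Fx_crit a = 2 * m^3" using m by (simp only: real_sqrt_abs) simp
  have "2 * (a + b) = 3 * m^2 - s^2" using m s by argo
  then have sad: "Fx_sad a b = (3 * m^2 - s^2) * s" by (simp add: Fx_sad_def s_def)
  have "0 \<le> (s - m)^2 * (s + 2 * m)" using m s by simp
  also have "\<dots> = Fx_crit a - Fx_sad a b"
    unfolding crit sad by (simp add: power2_eq_square power3_eq_cube algebra_simps)
  finally show ?thesis by simp
qed

text \<open>
  From the saddle force on, \<open>Fx / (2*(a + b))\<close> is at least the radius \<open>sqrt (1 - 2*b)\<close>, so the circle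
  carries no critical point off the axis; at equality the candidate point lies on the axis.
\<close>

lemma critical_point_on_x_axis:
  assumes "a > 0" "b > 0" "Fx > 0" "b < 1/2 \<Longrightarrow> Fx_sad a b \<le> Fx"
  shows "critical_point (V_F a b Fx 0) (x, y) \<longleftrightarrow> y = 0 \<and> x^3 - (1 + 2*a) * x + Fx = 0"
proof -
  have False if "y \<noteq> 0" "x = Fx / (2 * (a + b))" "x^2 + y^2 = 1 - 2*b"
  proof -
    have "x^2 < 1 - 2*b" using that(1) zero_less_power2[of y] that(3) by linarith
    have "0 \<le> x^2" by simp
    with \<open>x^2 < 1 - 2*b\<close> have "b < 1/2" by argo
    have "x < sqrt (1 - 2*b)" using \<open>x^2 < 1 - 2*b\<close> by (rule real_less_rsqrt)
    then have "Fx < Fx_sad a b" using that(2) assms by (simp add: Fx_sad_def field_simps)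
    with assms(4)[OF \<open>b < 1/2\<close>] show False by simp
  qed
  then show ?thesis using assms by (auto simp: critical_point_Fy_0_iff)
qed

text \<open>
  A negative root satisfies \<open>x * (x^2 - (1 + 2*a)) = - Fx < 0\<close>, which puts \<open>x^2\<close> above both thresholds.
\<close>

lemma well_negative_x:
  assumes "a > 0" "b > 0" "Fx > 0" "x < 0" "x^3 - (1 + 2*a) * x + Fx = 0"
  shows "well (V_F a b Fx 0) (x, 0)"
proof (rule well_x_axis)
  show "critical_point (V_F a b Fx 0) (x, 0)" using assms by (simp add: critical_point_Fy_0_iff)
  have "x * (x^2 - (1 + 2*a)) < 0"
    using assms by (simp add: algebra_simps power2_eq_square power3_eq_cube)
  then have "x^2 > 1 + 2*a" using assms by (simp add: mult_less_0_iff)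
  then show "x^2 > (1 + 2*a) / 3" "x^2 > 1 - 2*b" using assms(1,2) by argo+
qed

lemma xk_0_well:
  assumes "a > 0" "b > 0" "Fx > 0"
  shows "has_nature (V_F a b Fx 0) (xk a Fx 0, 0) Well"
proof -
  have c: "1 + 2*a > 0" using assms by simp
  have "\<exists>t<0. trig_root (1 + 2*a) Fx 0 = of_real t \<and> t^3 - (1 + 2*a) * t + Fx = 0"
  proof (cases Fx "sqrt (4 * (1 + 2*a)^3 / 27)" rule: linorder_cases)
    case less
    from trig_roots_below_crit[OF c assms(3) less] show ?thesis by (metis diff_self mult_zero_left)
  next
    case equal
    from trig_roots_at_crit[OF c assms(3) equal] show ?thesis
      using c assms(3) equal
      by (intro exI[of _ "- 2 * sqrt ((1 + 2*a) / 3)"] conjI iffD2[OF trig_roots_at_crit(4)]) auto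
  next
    case greater
    from trig_roots_above_crit[OF c assms(3) greater] show ?thesis by metis
  qed
  then obtain t where "t < 0" "xk a Fx 0 = of_real t" "t^3 - (1 + 2*a) * t + Fx = 0"
    by (auto simp: xk_def)
  then show ?thesis
    using well_negative_x[OF assms] by (auto simp: real_point_def intro!: exI[of _ t])
qed

lemma table_Fx_eq_crit:
  assumes "a > 0" "b > 0" "Fx > 0" "Fx = Fx_crit a"
  shows "critical_table (V_F a b Fx 0)
    [((xk a Fx 0, 0), Well), ((xk a Fx 1, 0), Unidentified), ((xk a Fx 2, 0), Unidentified)]"
proof -
  define m where "m = sqrt ((1 + 2*a) / 3)"
  have m: "m > 0" using assms by (simp add: m_def)
  note r = trig_roots_at_crit[of "1 + 2*a" Fx, folded m_def xk_def]
  have roots: "xk a Fx 0 = of_real (- 2 * m)" "xk a Fx 1 = of_real m" "xk a Fx 2 = of_real m"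
    and cubic: "\<And>t. t^3 - (1 + 2*a) * t + Fx = 0 \<longleftrightarrow> t = - 2 * m \<or> t = m"
    using r assms by (auto simp: Fx_crit_def)
  have crit: "critical_point (V_F a b Fx 0) (x, y) \<longleftrightarrow> y = 0 \<and> (x = - 2 * m \<or> x = m)" for x y
    unfolding cubic[symmetric] using assms Fx_sad_le_Fx_crit
    by (intro critical_point_on_x_axis) auto
  have "well (V_F a b Fx 0) (- 2 * m, 0)"
  proof (rule well_negative_x[OF assms(1-3)])
    show "- 2 * m < 0" using m by simp
    show "(- 2 * m)^3 - (1 + 2*a) * (- 2 * m) + Fx = 0" unfolding cubic by simp
  qed
  then have "critical_table (V_F a b Fx 0) ([] @ map (map_prod real_point id)
      [((- 2 * m, 0), Well), ((m, 0), Unidentified), ((m, 0), Unidentified)] @ [])"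
    by (intro critical_tableI) (use m in \<open>auto simp: crit\<close>)
  then show ?thesis by (simp add: real_point_def roots del: One_nat_def)
qed

lemma table_Fx_gt_crit:
  assumes "a > 0" "b > 0" "Fx > Fx_crit a"
  shows "critical_table (V_F a b Fx 0)
    [((xk a Fx 0, 0), Well), ((xk a Fx 1, 0), Nonexistent), ((xk a Fx 2, 0), Nonexistent)]"
proof -
  have "Fx_crit a \<ge> 0" using assms by (simp add: Fx_crit_def)
  then have "Fx > 0" using assms by linarith
  then obtain t where t: "xk a Fx 0 = of_real t" "t < 0" "xk a Fx 1 \<notin> \<real>" "xk a Fx 2 \<notin> \<real>"
    and cubic: "\<And>u. u^3 - (1 + 2*a) * u + Fx = 0 \<longleftrightarrow> u = t"
    using trig_roots_above_crit[of "1 + 2*a" Fx] assms unfolding xk_def Fx_crit_def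
    by (metis add_pos_pos mult_pos_pos zero_less_numeral zero_less_one)
  have crit: "critical_point (V_F a b Fx 0) (x, y) \<longleftrightarrow> y = 0 \<and> x = t" for x y
    unfolding cubic[symmetric] using assms \<open>Fx > 0\<close> Fx_sad_le_Fx_crit[of a b]
    by (intro critical_point_on_x_axis) auto
  have "well (V_F a b Fx 0) (t, 0)"
    using assms t \<open>Fx > 0\<close> cubic by (intro well_negative_x) auto
  then have "critical_table (V_F a b Fx 0) ([] @ map (map_prod real_point id) [((t, 0), Well)] @
      [((xk a Fx 1, 0), Nonexistent), ((xk a Fx 2, 0), Nonexistent)])"
    by (intro critical_tableI) (use t in \<open>auto simp: crit mem_range_real_point_iff\<close>)
  then show ?thesis by (simp add: real_point_def t(1))
qed

lemma xk_below_crit: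
  assumes "a > 0" "Fx > 0" "Fx < Fx_crit a"
  obtains t\<^sub>0 t\<^sub>1 t\<^sub>2 :: real where
    "xk a Fx 0 = of_real t\<^sub>0" "xk a Fx 1 = of_real t\<^sub>1" "xk a Fx 2 = of_real t\<^sub>2"
    "t\<^sub>0 < 0" "0 < t\<^sub>2" "t\<^sub>2 < t\<^sub>1" "t\<^sub>2^2 < (1 + 2*a) / 3" "(1 + 2*a) / 3 < t\<^sub>1^2"
    "\<And>t. t^3 - (1 + 2*a) * t + Fx = (t - t\<^sub>0) * (t - t\<^sub>1) * (t - t\<^sub>2)"
proof -
  have c: "1 + 2*a > 0" using assms by simp
  obtain t\<^sub>0 t\<^sub>1 t\<^sub>2 :: real where r: "xk a Fx 0 = of_real t\<^sub>0" "xk a Fx 1 = of_real t\<^sub>1" "xk a Fx 2 = of_real t\<^sub>2"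
    and t: "t\<^sub>0 < 0" "0 < t\<^sub>2" "t\<^sub>2 < sqrt ((1 + 2*a) / 3)" "sqrt ((1 + 2*a) / 3) < t\<^sub>1"
    and f: "\<And>t. t^3 - (1 + 2*a) * t + Fx = (t - t\<^sub>0) * (t - t\<^sub>1) * (t - t\<^sub>2)"
    using trig_roots_below_crit[OF c assms(2) assms(3)[unfolded Fx_crit_def]] unfolding xk_def by metis
  have s: "sqrt ((1 + 2*a) / 3) ^ 2 = (1 + 2*a) / 3" "sqrt ((1 + 2*a) / 3) > 0" using c by auto
  have "t\<^sub>2^2 < sqrt ((1 + 2*a) / 3) ^ 2" "sqrt ((1 + 2*a) / 3) ^ 2 < t\<^sub>1^2"
    using t s(2) by (intro power_strict_mono; simp)+
  then have "t\<^sub>2^2 < (1 + 2*a) / 3" "(1 + 2*a) / 3 < t\<^sub>1^2" by (simp_all only: s(1))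
  with r t f show ?thesis by (intro that) auto
qed

text \<open>
  The common part of all tables for a force that is subcritical but leaves no critical point off the
  axis: only the natures of the two positive roots differ from case to case.
\<close>

lemma table_Fx_lt_crit_no_off_axis:
  assumes "a > 0" "b > 0" "Fx > 0" and t: "xk a Fx 0 = of_real t\<^sub>0" "xk a Fx 1 = of_real t\<^sub>1" "xk a Fx 2 = of_real t\<^sub>2"
    "t\<^sub>0 < 0" "0 < t\<^sub>2" "t\<^sub>2 < t\<^sub>1"
    and cubic: "\<And>t. t^3 - (1 + 2*a) * t + Fx = (t - t\<^sub>0) * (t - t\<^sub>1) * (t - t\<^sub>2)"
    and off: "b < 1/2 \<Longrightarrow> Fx_sad a b \<le> Fx"
    and nature: "n\<^sub>1 \<noteq> Nonexistent" "n\<^sub>2 \<noteq> Nonexistent"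
      "critical_point (V_F a b Fx 0) (t\<^sub>1, 0) \<Longrightarrow> has_nature (V_F a b Fx 0) (real_point (t\<^sub>1, 0)) n\<^sub>1"
      "critical_point (V_F a b Fx 0) (t\<^sub>2, 0) \<Longrightarrow> has_nature (V_F a b Fx 0) (real_point (t\<^sub>2, 0)) n\<^sub>2"
    and N: "\<forall>(z, n) \<in> set N. n = Nonexistent \<and> z \<notin> range real_point"
  shows "critical_table (V_F a b Fx 0)
    ([((xk a Fx 0, 0), Well), ((xk a Fx 1, 0), n\<^sub>1), ((xk a Fx 2, 0), n\<^sub>2)] @ N)"
proof -
  have crit: "critical_point (V_F a b Fx 0) (x, y) \<longleftrightarrow> y = 0 \<and> (x = t\<^sub>0 \<or> x = t\<^sub>1 \<or> x = t\<^sub>2)" for x y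
    using critical_point_on_x_axis[OF assms(1-3) off] cubic by auto
  have "well (V_F a b Fx 0) (t\<^sub>0, 0)"
    using cubic[of t\<^sub>0] by (intro well_negative_x assms) simp
  then have "critical_table (V_F a b Fx 0) ([] @ map (map_prod real_point id)
      [((t\<^sub>0, 0), Well), ((t\<^sub>1, 0), n\<^sub>1), ((t\<^sub>2, 0), n\<^sub>2)] @ N)"
    by (intro critical_tableI) (use N nature t in \<open>auto simp: crit\<close>)
  then show ?thesis by (simp add: real_point_def t del: One_nat_def)
qed

lemma y_saddle_not_real:
  assumes "a > 0" "b > 0" "b < 1/2" "Fx_sad a b < Fx"
  shows "y_saddle a b Fx \<notin> \<real>"
  unfolding y_saddle_def
proof (rule csqrt_of_neg_real)
  have "sqrt (1 - 2*b) < Fx / (2 * (a + b))"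
    using assms by (simp add: Fx_sad_def field_simps)
  then have "sqrt (1 - 2*b) ^ 2 < (Fx / (2 * (a + b)))^2"
    using assms by (intro power_strict_mono) auto
  then show "(1 - 2*b) - (Fx / (2 * (a + b)))^2 < 0" using assms by simp
qed

text \<open>
  Hence the cubic takes the value \<open>Fx - Fx_sad\<close> at \<open>sqrt (1 - 2*b)\<close>: comparing the force with the
  saddle force locates \<open>sqrt (1 - 2*b)\<close> relative to the roots of the cubic, and these comparisons
  decide the signs of \<open>V\<^sub>y\<^sub>y\<close> at the critical points on the axis.
\<close>

lemma Fx_sad_eq_neg_cubic:
  assumes "b < 1/2" "s = sqrt (1 - 2*b)"
  shows "Fx_sad a b = - (s^3 - (1 + 2*a) * s)"
proof -
  have "s^3 = (1 - 2*b) * s" using assms by (simp add: power3_eq_cube)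
  moreover have "Fx_sad a b = 2 * (a + b) * s" by (simp add: Fx_sad_def assms(2))
  ultimately show ?thesis by (simp add: algebra_simps)
qed

lemma R1_imp_square_gt:
  assumes "s \<in> R1 a" "a > 0"
  shows "(1 + 2*a) / 3 < s^2"
proof -
  have "sqrt ((1 + 2*a) / 3) < s" using assms by (simp add: R1_def real_sqrt_divide)
  then have "sqrt ((1 + 2*a) / 3) ^ 2 < s^2" using assms(2) by (intro power_strict_mono) auto
  then show ?thesis using assms(2) by simp
qed

lemma R2_imp_square_lt:
  assumes "s \<in> R2 a" "a > 0"
  shows "s^2 < (1 + 2*a) / 3"
proof -
  have "0 < s" "s < sqrt ((1 + 2*a) / 3)" using assms by (auto simp: R2_def real_sqrt_divide)
  then have "s^2 < sqrt ((1 + 2*a) / 3) ^ 2" by (intro power_strict_mono) auto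
  then show ?thesis using assms(2) by simp
qed

lemma table_Fx_lt_sad:
  assumes "a > 0" "b > 0" "Fx > 0" "b < 1/2" "Fx < Fx_sad a b"
  shows "critical_table (V_F a b Fx 0)
            [((xk a Fx 0, 0), Well),
             ((xk a Fx 1, 0), Well),
             ((xk a Fx 2, 0), Hill),
             ((x_saddle a b Fx, y_saddle a b Fx), Saddle),
             ((x_saddle a b Fx, - y_saddle a b Fx), Saddle)]"
proof -
  have "Fx < Fx_crit a" using assms Fx_sad_le_Fx_crit[of a b] by simp
  from xk_below_crit[OF assms(1,3) this] obtain t\<^sub>0 t\<^sub>1 t\<^sub>2 where
    r: "xk a Fx 0 = of_real t\<^sub>0" "xk a Fx 1 = of_real t\<^sub>1" "xk a Fx 2 = of_real t\<^sub>2"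
    and t: "t\<^sub>0 < 0" "0 < t\<^sub>2" "t\<^sub>2 < t\<^sub>1" "t\<^sub>2^2 < (1 + 2*a) / 3" "(1 + 2*a) / 3 < t\<^sub>1^2"
    and f: "\<And>t. t^3 - (1 + 2*a) * t + Fx = (t - t\<^sub>0) * (t - t\<^sub>1) * (t - t\<^sub>2)" by metis
  define s where "s = sqrt (1 - 2*b)"
  have s: "s > 0" "s^2 = 1 - 2*b" using assms by (auto simp: s_def)
  define X where "X = Fx / (2 * (a + b))"
  define Y where "Y = sqrt ((1 - 2*b) - X^2)"
  have X: "X > 0" "X < s" using assms by (auto simp: X_def s_def Fx_sad_def field_simps)
  then have "X^2 < s^2" by (intro power_strict_mono) auto
  then have Y: "Y > 0" "Y^2 = (1 - 2*b) - X^2" using s by (auto simp: Y_def)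
  have xs: "x_saddle a b Fx = of_real X" "y_saddle a b Fx = of_real Y"
    unfolding x_saddle_def y_saddle_def X_def[symmetric] Y_def
    by (rule refl, rule csqrt_of_real) (use Y zero_le_power2[of Y] in linarith)
  have "(s - t\<^sub>0) * ((s - t\<^sub>1) * (s - t\<^sub>2)) < 0" using f[of s] Fx_sad_eq_neg_cubic[OF assms(4) s_def, of a] assms(5) by (simp add: mult.assoc)
  then have "(s - t\<^sub>1) * (s - t\<^sub>2) < 0" using s t by (simp add: mult_less_0_iff)
  then have "t\<^sub>2 < s" "s < t\<^sub>1" using t by (auto simp: mult_less_0_iff)
  then have t2: "t\<^sub>2^2 < 1 - 2*b" and t1: "1 - 2*b < t\<^sub>1^2"
    unfolding s(2)[symmetric] using s(1) t(2) by (auto intro: power_strict_mono)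
  have crit: "critical_point (V_F a b Fx 0) (x, y) \<longleftrightarrow>
    y = 0 \<and> (x = t\<^sub>0 \<or> x = t\<^sub>1 \<or> x = t\<^sub>2) \<or> x = X \<and> (y = Y \<or> y = - Y)" for x y
  proof -
    have "x^2 + y^2 = 1 - 2*b \<longleftrightarrow> y^2 = Y^2" if "x = X" using Y that by auto
    then have "y \<noteq> 0 \<and> x = X \<and> x^2 + y^2 = 1 - 2*b \<longleftrightarrow> x = X \<and> y \<noteq> 0 \<and> y^2 = Y^2"
      by blast
    also have "\<dots> \<longleftrightarrow> x = X \<and> (y = Y \<or> y = - Y)"
      using Y(1) by (auto simp: power2_eq_iff)
    finally have "y \<noteq> 0 \<and> x = X \<and> x^2 + y^2 = 1 - 2*b \<longleftrightarrow> x = X \<and> (y = Y \<or> y = - Y)" .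
    moreover have "a + b > 0" using assms by simp
    ultimately show ?thesis
      using critical_point_Fy_0_iff[of a b Fx x y] unfolding f X_def[symmetric] by auto
  qed
  have "well (V_F a b Fx 0) (t\<^sub>0, 0)"
    using f[of t\<^sub>0] by (intro well_negative_x assms t) simp
  moreover have "well (V_F a b Fx 0) (t\<^sub>1, 0)" using crit t t1 by (intro well_x_axis) auto
  moreover have "hill (V_F a b Fx 0) (t\<^sub>2, 0)" using crit t t2 by (intro hill_x_axis) auto
  moreover have "saddle (V_F a b Fx 0) (X, Y)" "saddle (V_F a b Fx 0) (X, - Y)"
    using crit Y assms by (auto intro!: saddle_off_x_axis)
  ultimately have "critical_table (V_F a b Fx 0) ([] @ map (map_prod real_point id)
      [((t\<^sub>0, 0), Well), ((t\<^sub>1, 0), Well), ((t\<^sub>2, 0), Hill), ((X, Y), Saddle), ((X, - Y), Saddle)] @ [])"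
    by (intro critical_tableI) (use t Y in \<open>auto simp: crit\<close>)
  then show ?thesis by (simp add: real_point_def r xs del: One_nat_def)
qed

text \<open>
  Beyond the saddle force \<open>sqrt (1 - 2*b)\<close> lies outside the interval between the two positive roots.
  Membership in \<open>R1\<close> or \<open>R2\<close> compares it with the turning point of the cubic, which separates these
  roots, and so tells on which side of the interval it lies.
\<close>

lemma tables_Fx_between_sad_and_crit:
  assumes "a > 0" "b > 0" "Fx > 0" "b < 1/2" "Fx_sad a b < Fx" "Fx < Fx_crit a"
  shows "sqrt (1 - 2*b) \<in> R1 a \<Longrightarrow>
            critical_table (V_F a b Fx 0)
              [((xk a Fx 0, 0), Well),
               ((xk a Fx 1, 0), Saddle),
               ((xk a Fx 2, 0), Hill),
               ((x_saddle a b Fx, y_saddle a b Fx), Nonexistent),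
               ((x_saddle a b Fx, - y_saddle a b Fx), Nonexistent)]" (is "_ \<Longrightarrow> ?T1")
    and "sqrt (1 - 2*b) \<in> R2 a \<Longrightarrow>
            critical_table (V_F a b Fx 0)
              [((xk a Fx 0, 0), Well),
               ((xk a Fx 1, 0), Well),
               ((xk a Fx 2, 0), Saddle),
               ((x_saddle a b Fx, y_saddle a b Fx), Nonexistent),
               ((x_saddle a b Fx, - y_saddle a b Fx), Nonexistent)]" (is "_ \<Longrightarrow> ?T2")
proof -
  from xk_below_crit[OF assms(1,3,6)] obtain t\<^sub>0 t\<^sub>1 t\<^sub>2 where
    r: "xk a Fx 0 = of_real t\<^sub>0" "xk a Fx 1 = of_real t\<^sub>1" "xk a Fx 2 = of_real t\<^sub>2"
    and t: "t\<^sub>0 < 0" "0 < t\<^sub>2" "t\<^sub>2 < t\<^sub>1" "t\<^sub>2^2 < (1 + 2*a) / 3" "(1 + 2*a) / 3 < t\<^sub>1^2"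
    and f: "\<And>t. t^3 - (1 + 2*a) * t + Fx = (t - t\<^sub>0) * (t - t\<^sub>1) * (t - t\<^sub>2)" by metis
  define s where "s = sqrt (1 - 2*b)"
  have s: "s > 0" "s^2 = 1 - 2*b" using assms by (auto simp: s_def)
  have N: "\<forall>(z, n) \<in> set [((x_saddle a b Fx, y_saddle a b Fx), Nonexistent),
      ((x_saddle a b Fx, - y_saddle a b Fx), Nonexistent)]. n = Nonexistent \<and> z \<notin> range real_point"
    using y_saddle_not_real[OF assms(1,2,4,5)] by (auto simp: mem_range_real_point_iff)
  have "0 < (s - t\<^sub>0) * ((s - t\<^sub>1) * (s - t\<^sub>2))" using f[of s] Fx_sad_eq_neg_cubic[OF assms(4) s_def, of a] assms(5) by (simp add: mult.assoc)
  then have "0 < (s - t\<^sub>1) * (s - t\<^sub>2)" using s t by (simp add: zero_less_mult_iff)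
  then have side: "s < t\<^sub>2 \<or> t\<^sub>1 < s" using t by (auto simp: zero_less_mult_iff)
  note table = table_Fx_lt_crit_no_off_axis[OF assms(1-3) r t(1-3) f less_imp_le[OF assms(5)] _ _ _ _ N]
  {
    assume "s \<in> R1 a"
    from R1_imp_square_gt[OF this assms(1)] have "(1 + 2*a) / 3 < s^2" .
    then have "\<not> s < t\<^sub>2" using t power_strict_mono[of s t\<^sub>2 2] s by auto
    then have "t\<^sub>2 < s" "t\<^sub>1 < s" using side t by auto
    then have "t\<^sub>2^2 < 1 - 2*b" "t\<^sub>1^2 < 1 - 2*b"
      unfolding s(2)[symmetric] using s(1) t(2,3) by (auto intro: power_strict_mono)
    with t(4,5) have "critical_table (V_F a b Fx 0)
      ([((xk a Fx 0, 0), Well), ((xk a Fx 1, 0), Saddle), ((xk a Fx 2, 0), Hill)] @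
       [((x_saddle a b Fx, y_saddle a b Fx), Nonexistent),
        ((x_saddle a b Fx, - y_saddle a b Fx), Nonexistent)])"
      by (intro table) (auto intro: saddle_x_axis hill_x_axis)
    then show ?T1 by simp
  }
  {
    assume "s \<in> R2 a"
    from R2_imp_square_lt[OF this assms(1)] have "s^2 < (1 + 2*a) / 3" .
    then have "\<not> t\<^sub>1 < s" using t power_strict_mono[of t\<^sub>1 s 2] s by auto
    then have "s < t\<^sub>2" "s < t\<^sub>1" using side t by auto
    then have "1 - 2*b < t\<^sub>2^2" "1 - 2*b < t\<^sub>1^2"
      unfolding s(2)[symmetric] using s(1) by (auto intro: power_strict_mono)
    with t(4,5) have "critical_table (V_F a b Fx 0)
      ([((xk a Fx 0, 0), Well), ((xk a Fx 1, 0), Well), ((xk a Fx 2, 0), Saddle)] @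
       [((x_saddle a b Fx, y_saddle a b Fx), Nonexistent),
        ((x_saddle a b Fx, - y_saddle a b Fx), Nonexistent)])"
      by (intro table) (auto intro: saddle_x_axis well_x_axis)
    then show ?T2 by simp
  }
qed

text \<open>
  Now \<open>sqrt (1 - 2*b)\<close> is itself a root, and both points \<open>(x_saddle, \<plusminus>y_saddle)\<close> coincide with it.
  Membership in \<open>R1\<close> or \<open>R2\<close> decides which of the two positive roots it is.
\<close>

lemma tables_Fx_eq_sad:
  assumes "a > 0" "b > 0" "Fx > 0" "b < 1/2" "Fx = Fx_sad a b" "Fx < Fx_crit a"
  shows "sqrt (1 - 2*b) \<in> R1 a \<Longrightarrow>
            critical_table (V_F a b Fx 0)
              [((xk a Fx 0, 0), Well),
               ((xk a Fx 1, 0), Unidentified),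
               ((xk a Fx 2, 0), Hill),
               ((x_saddle a b Fx, y_saddle a b Fx), Unidentified),
               ((x_saddle a b Fx, - y_saddle a b Fx), Unidentified)]" (is "_ \<Longrightarrow> ?T1")
    and "sqrt (1 - 2*b) \<in> R2 a \<Longrightarrow>
            critical_table (V_F a b Fx 0)
              [((xk a Fx 0, 0), Well),
               ((xk a Fx 1, 0), Well),
               ((xk a Fx 2, 0), Unidentified),
               ((x_saddle a b Fx, y_saddle a b Fx), Unidentified),
               ((x_saddle a b Fx, - y_saddle a b Fx), Unidentified)]" (is "_ \<Longrightarrow> ?T2")
proof -
  from xk_below_crit[OF assms(1,3,6)] obtain t\<^sub>0 t\<^sub>1 t\<^sub>2 where
    r: "xk a Fx 0 = of_real t\<^sub>0" "xk a Fx 1 = of_real t\<^sub>1" "xk a Fx 2 = of_real t\<^sub>2"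
    and t: "t\<^sub>0 < 0" "0 < t\<^sub>2" "t\<^sub>2 < t\<^sub>1" "t\<^sub>2^2 < (1 + 2*a) / 3" "(1 + 2*a) / 3 < t\<^sub>1^2"
    and f: "\<And>t. t^3 - (1 + 2*a) * t + Fx = (t - t\<^sub>0) * (t - t\<^sub>1) * (t - t\<^sub>2)" by metis
  define s where "s = sqrt (1 - 2*b)"
  have s: "s > 0" "s^2 = 1 - 2*b" using assms by (auto simp: s_def)
  have X: "Fx / (2 * (a + b)) = s" using assms by (simp add: Fx_sad_def s_def)
  have xs: "x_saddle a b Fx = of_real s" "y_saddle a b Fx = 0"
    unfolding x_saddle_def y_saddle_def X using s by auto
  have crit: "critical_point (V_F a b Fx 0) (x, y) \<longleftrightarrow> y = 0 \<and> (x = t\<^sub>0 \<or> x = t\<^sub>1 \<or> x = t\<^sub>2)" for x y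
    using critical_point_on_x_axis[OF assms(1-3), of x y] assms(5) f by auto
  have well0: "well (V_F a b Fx 0) (t\<^sub>0, 0)"
    using f[of t\<^sub>0] by (intro well_negative_x assms t) simp
  have "(s - t\<^sub>0) * (s - t\<^sub>1) * (s - t\<^sub>2) = 0" using f[of s] Fx_sad_eq_neg_cubic[OF assms(4) s_def, of a] assms(5) by simp
  then have side: "s = t\<^sub>2 \<or> s = t\<^sub>1" using s t by auto
  {
    assume "s \<in> R1 a"
    from R1_imp_square_gt[OF this assms(1)] have "(1 + 2*a) / 3 < s^2" .
    then have s1: "s = t\<^sub>1" using side t by auto
    have "t\<^sub>2^2 < s^2" using s s1 t by (auto intro: power_strict_mono)
    then have "hill (V_F a b Fx 0) (t\<^sub>2, 0)" using crit t s by (intro hill_x_axis) auto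
    then have "critical_table (V_F a b Fx 0) ([] @ map (map_prod real_point id)
        [((t\<^sub>0, 0), Well), ((t\<^sub>1, 0), Unidentified), ((t\<^sub>2, 0), Hill), ((t\<^sub>1, 0), Unidentified), ((t\<^sub>1, 0), Unidentified)] @ [])"
      by (intro critical_tableI) (use t well0 in \<open>auto simp: crit\<close>)
    then show ?T1 by (simp add: real_point_def r xs s1 del: One_nat_def)
  }
  {
    assume "s \<in> R2 a"
    from R2_imp_square_lt[OF this assms(1)] have "s^2 < (1 + 2*a) / 3" .
    then have s2: "s = t\<^sub>2" using side t by auto
    have "s^2 < t\<^sub>1^2" using s s2 t by (auto intro: power_strict_mono)
    then have "well (V_F a b Fx 0) (t\<^sub>1, 0)" using crit t s by (intro well_x_axis) auto
    then have "critical_table (V_F a b Fx 0) ([] @ map (map_prod real_point id)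
        [((t\<^sub>0, 0), Well), ((t\<^sub>1, 0), Well), ((t\<^sub>2, 0), Unidentified), ((t\<^sub>2, 0), Unidentified), ((t\<^sub>2, 0), Unidentified)] @ [])"
      by (intro critical_tableI) (use t well0 in \<open>auto simp: crit\<close>)
    then show ?T2 by (simp add: real_point_def r xs s2 del: One_nat_def)
  }
qed

lemma table_Fx_lt_crit_b_ge_half:
  assumes "a > 0" "b > 0" "Fx > 0" "b \<ge> 1/2" "Fx < Fx_crit a"
  shows "critical_table (V_F a b Fx 0)
            [((xk a Fx 0, 0), Well),
             ((xk a Fx 1, 0), Well),
             ((xk a Fx 2, 0), Saddle)]"
proof -
  from xk_below_crit[OF assms(1,3,5)] obtain t\<^sub>0 t\<^sub>1 t\<^sub>2 where
    r: "xk a Fx 0 = of_real t\<^sub>0" "xk a Fx 1 = of_real t\<^sub>1" "xk a Fx 2 = of_real t\<^sub>2"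
    and t: "t\<^sub>0 < 0" "0 < t\<^sub>2" "t\<^sub>2 < t\<^sub>1" "t\<^sub>2^2 < (1 + 2*a) / 3" "(1 + 2*a) / 3 < t\<^sub>1^2"
    and f: "\<And>t. t^3 - (1 + 2*a) * t + Fx = (t - t\<^sub>0) * (t - t\<^sub>1) * (t - t\<^sub>2)" by metis
  have "t\<^sub>1^2 > 0" "t\<^sub>2^2 > 0" using t by auto
  then have "1 - 2*b < t\<^sub>1^2" "1 - 2*b < t\<^sub>2^2" using assms(4) by argo+
  with t(4,5) assms(4) have "critical_table (V_F a b Fx 0)
      ([((xk a Fx 0, 0), Well), ((xk a Fx 1, 0), Well), ((xk a Fx 2, 0), Saddle)] @ [])"
    by (intro table_Fx_lt_crit_no_off_axis[OF assms(1-3) r t(1-3) f])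
      (auto intro: saddle_x_axis well_x_axis)
  then show ?thesis by simp
qed

section \<open>No force\<close>

text \<open>
  For \<open>b = 1/2\<close> the Hessian at the origin is singular, so for \<open>b \<ge> 1/2\<close> ascent along the y-axis is
  shown directly from the quartic term instead of by the second-derivative test.
\<close>

lemma tables_no_force:
  assumes "a > 0" "b > 0"
  shows "b < 1/2 \<Longrightarrow>
        critical_table (V_F a b 0 0)
          [((0, 0), Hill),
           ((complex_of_real (sqrt (1 + 2*a)), 0), Well),
           ((- complex_of_real (sqrt (1 + 2*a)), 0), Well),
           ((0, complex_of_real (sqrt (1 - 2*b))), Saddle),
           ((0, - complex_of_real (sqrt (1 - 2*b))), Saddle)]" (is "_ \<Longrightarrow> ?A")
    and "b \<ge> 1/2 \<Longrightarrow>
        critical_table (V_F a b 0 0)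
          [((0, 0), Saddle),
           ((complex_of_real (sqrt (1 + 2*a)), 0), Well),
           ((- complex_of_real (sqrt (1 + 2*a)), 0), Well)]" (is "_ \<Longrightarrow> ?B")
proof -
  define w where "w = sqrt (1 + 2*a)"
  have w: "w > 0" "w^2 = 1 + 2*a" using assms by (auto simp: w_def)
  have "x^3 - (1 + 2*a) * x = x * (x - w) * (x + w)" for x
    unfolding w(2)[symmetric] by (simp add: algebra_simps power2_eq_square power3_eq_cube)
  then have crit: "critical_point (V_F a b 0 0) (x, y) \<longleftrightarrow>
      y = 0 \<and> (x = 0 \<or> x = w \<or> x = - w) \<or> y \<noteq> 0 \<and> x = 0 \<and> y^2 = 1 - 2*b" for x y
    using assms by (auto simp: critical_point_Fy_0_iff)
  have wells: "well (V_F a b 0 0) (w, 0)" "well (V_F a b 0 0) (- w, 0)"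
    using crit w assms by (auto intro!: well_x_axis)
  {
    assume b: "b < 1/2"
    define s where "s = sqrt (1 - 2*b)"
    have s: "s > 0" "s^2 = 1 - 2*b" using b by (auto simp: s_def)
    have crit': "critical_point (V_F a b 0 0) (x, y) \<longleftrightarrow>
        y = 0 \<and> (x = 0 \<or> x = w \<or> x = - w) \<or> x = 0 \<and> (y = s \<or> y = - s)" for x y
      unfolding crit s(2)[symmetric] using s(1) by (auto simp: power2_eq_iff)
    have "hill (V_F a b 0 0) (0, 0)" using crit b assms by (intro hill_x_axis) auto
    moreover have "saddle (V_F a b 0 0) (0, s)" "saddle (V_F a b 0 0) (0, - s)"
      using crit' s b assms by (auto intro!: saddle_off_x_axis)
    ultimately have "critical_table (V_F a b 0 0) ([] @ map (map_prod real_point id)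
        [((0, 0), Hill), ((w, 0), Well), ((- w, 0), Well), ((0, s), Saddle), ((0, - s), Saddle)] @ [])"
      by (intro critical_tableI) (use w s wells in \<open>auto simp: crit'\<close>)
    then show ?A by (simp add: real_point_def w_def[symmetric] s_def[symmetric])
  }
  {
    assume b: "b \<ge> 1/2"
    have crit': "critical_point (V_F a b 0 0) (x, y) \<longleftrightarrow> y = 0 \<and> (x = 0 \<or> x = w \<or> x = - w)" for x y
    proof -
      have "y^2 > 0 \<Longrightarrow> y^2 \<noteq> 1 - 2*b" using b by argo
      then show ?thesis unfolding crit by auto
    qed
    have c0: "critical_point (V_F a b 0 0) (0, 0)" using crit by simp
    have "\<not> local_minimum (V_F a b 0 0) (0, 0)"
      using V_F_ray_sign[OF c0 refl, of "-1" 1 0] assms by (intro not_local_minimumI[of _ 0 1 0 0]) auto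
    moreover have "\<not> local_maximum (V_F a b 0 0) (0, 0)"
    proof (rule not_local_maximumI[of _ 0 0 0 1])
      show "\<forall>\<^sub>F t in at_right (0::real). V_F a b 0 0 (0, 0) < V_F a b 0 0 (0 + t * 0, 0 + t * 1)"
        using eventually_at_right_less[of 0]
      proof eventually_elim
        case (elim t)
        have "0 < (t^2)^2 / 4" using elim by simp
        moreover have "(1 - 2*b) / 2 * t^2 \<le> 0" using b by (intro mult_nonpos_nonneg) auto
        moreover have "V_F a b 0 0 (0, t) - V_F a b 0 0 (0, 0) = (t^2)^2 / 4 - (1 - 2*b) / 2 * t^2"
          by (simp add: V_F_eq_polynomial)
        ultimately have "V_F a b 0 0 (0, t) - V_F a b 0 0 (0, 0) > 0" by linarith
        then show ?case by simp
      qed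
    qed simp
    ultimately have "saddle (V_F a b 0 0) (0, 0)" using c0 by (simp add: saddle_def)
    then have "critical_table (V_F a b 0 0) ([] @ map (map_prod real_point id)
        [((0, 0), Saddle), ((w, 0), Well), ((- w, 0), Well)] @ [])"
      by (intro critical_tableI) (use w wells in \<open>auto simp: crit'\<close>)
    then show ?B by (simp add: real_point_def w_def[symmetric])
  }
qed

section \<open>Force along the y-axis\<close>

text \<open>
  The negative root \<open>t\<close> of the cubic and the points on the circle \<open>x^2 + y^2 = 1 + 2*a\<close> interact only
  with each other; the other roots are positive. So the entries for the other roots are parameters:
  existing ones in \<open>E\<close>, nonexistent ones in \<open>N\<close>. The comparison of \<open>Fy\<close> with \<open>Fy_sad\<close> decides both
  whether the circle carries critical points and on which side of \<open>- sqrt (1 + 2*a)\<close> the root \<open>t\<close> lies.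
\<close>

lemma table_Fx_0:
  fixes E :: "((real \<times> real) \<times> nature) list"
  assumes ab: "a > 0" "b > 0" and Fy: "Fy > 0"
    and y0: "y0 b Fy = of_real t" and neg: "t < 0"
    and roots: "\<And>y. y^3 - (1 - 2*b) * y + Fy = 0 \<longleftrightarrow> y = t \<or> (0, y) \<in> fst ` set E"
    and E: "\<forall>(p, n) \<in> set E. fst p = 0 \<and> snd p > 0 \<and> n \<noteq> Nonexistent \<and>
      has_nature (V_F a b 0 Fy) (real_point p) n"
    and distinct: "sorted_wrt (\<lambda>s t. fst s = fst t \<longrightarrow> snd s = Unidentified \<and> snd t = Unidentified) E"
    and N: "\<forall>(z, n) \<in> set N. n = Nonexistent \<and> z \<notin> range real_point"
  shows "critical_table (V_F a b 0 Fy) ((N @ map (map_prod real_point id) E) @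
    (if Fy < Fy_sad a b then
       [((0, y0 b Fy), Saddle),
        ((x_well a b Fy, y_well a b Fy), Well),
        ((- x_well a b Fy, y_well a b Fy), Well)]
     else if Fy > Fy_sad a b then
       [((0, y0 b Fy), Well),
        ((x_well a b Fy, y_well a b Fy), Nonexistent),
        ((- x_well a b Fy, y_well a b Fy), Nonexistent)]
     else
       [((0, y0 b Fy), Unidentified),
        ((x_well a b Fy, y_well a b Fy), Unidentified),
        ((- x_well a b Fy, y_well a b Fy), Unidentified)]))"
    (is "critical_table ?V _")
    and "Fy = Fy_sad a b \<Longrightarrow> y_well a b Fy = y0 b Fy \<and> x_well a b Fy = 0"
proof -
  define w where "w = sqrt (1 + 2*a)"
  have w: "w > 0" "w^2 = 1 + 2*a" using ab by (auto simp: w_def)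
  define d where "d = 2 * (a + b)"
  have d: "d > 0" "1 - 2*b = w^2 - d" "a + b > 0" using ab w by (auto simp: d_def)
  have sad: "Fy_sad a b = d * w" by (simp add: Fy_sad_def d_def w_def)
  have yw: "y_well a b Fy = of_real (- (Fy / d))" by (simp add: y_well_def d_def)
  have xw: "x_well a b Fy = csqrt (complex_of_real (w^2 - (Fy / d)^2))"
    unfolding x_well_def w(2) d_def ..
  have t: "t < 0" "t^3 - (1 - 2*b) * t + Fy = 0" using neg roots by auto
  have "t * (t^2 - (1 - 2*b)) < 0"
    using t Fy by (simp add: algebra_simps power2_eq_square power3_eq_cube)
  then have tb: "t^2 > 1 - 2*b" using t by (simp add: mult_less_0_iff)
  moreover have "t^2 > 0" using t by simp
  ultimately have tb3: "t^2 > (1 - 2*b) / 3" by argo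
  \<comment> \<open>\<open>P\<close> is the quadratic cofactor of the root \<open>t\<close>, evaluated at \<open>- w\<close>\<close>
  define P where "P = w^2 - w * t + (t^2 - (1 - 2*b))"
  have "w * t < 0" using w t by (simp add: mult_pos_neg)
  moreover have "w^2 > 0" using w(1) by simp
  ultimately have P: "P > 0" unfolding P_def using tb by linarith
  have "Fy_sad a b - Fy = (w + t) * P"
    using t(2) unfolding sad P_def d(2) by (simp add: algebra_simps power2_eq_square power3_eq_cube)
  then have side: "Fy < Fy_sad a b \<longleftrightarrow> - t < w" "Fy > Fy_sad a b \<longleftrightarrow> w < - t"
    "Fy = Fy_sad a b \<longleftrightarrow> w = - t"
    using P zero_less_mult_iff[of "w + t" P] mult_less_0_iff[of "w + t" P] mult_eq_0_iff[of "w + t" P]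
    by linarith+
  have crit: "critical_point ?V (x, y) \<longleftrightarrow>
      (x, y) = (0, t) \<or> (x, y) \<in> fst ` set E \<or> x \<noteq> 0 \<and> y = - (Fy / d) \<and> x^2 + y^2 = w^2" for x y
  proof -
    have "(x, y) \<in> fst ` set E \<Longrightarrow> x = 0" using E by fastforce
    then show ?thesis
      unfolding critical_point_Fx_0_iff[OF d(3)] roots w(2) d_def by auto
  qed
  have c0: "critical_point ?V (0, t)" by (simp add: crit)
  have E': "\<forall>(p, n) \<in> set E. n \<noteq> Nonexistent \<and> has_nature ?V (real_point p) n" using E by auto
  have ne: "fst s \<noteq> (0, t)" "x \<noteq> 0 \<Longrightarrow> fst s \<noteq> (x, y)" if "s \<in> set E" for s x y
    using E t that by fastforce+
  consider (less) "Fy < Fy_sad a b" | (greater) "Fy > Fy_sad a b" | (equal) "Fy = Fy_sad a b" by linarith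
  then show "critical_table ?V ((N @ map (map_prod real_point id) E) @
    (if Fy < Fy_sad a b then
       [((0, y0 b Fy), Saddle),
        ((x_well a b Fy, y_well a b Fy), Well),
        ((- x_well a b Fy, y_well a b Fy), Well)]
     else if Fy > Fy_sad a b then
       [((0, y0 b Fy), Well),
        ((x_well a b Fy, y_well a b Fy), Nonexistent),
        ((- x_well a b Fy, y_well a b Fy), Nonexistent)]
     else
       [((0, y0 b Fy), Unidentified),
        ((x_well a b Fy, y_well a b Fy), Unidentified),
        ((- x_well a b Fy, y_well a b Fy), Unidentified)]))"
  proof cases
    case less
    define X where "X = sqrt (w^2 - (Fy / d)^2)"
    have "Fy / d < w" using less d unfolding sad by (simp add: field_simps)
    then have "(Fy / d)^2 < w^2" using Fy d by (intro power_strict_mono) auto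
    then have X: "X > 0" "X^2 = w^2 - (Fy / d)^2" by (auto simp: X_def)
    have xX: "x_well a b Fy = of_real X"
      unfolding xw X_def using \<open>(Fy / d)^2 < w^2\<close> by (intro csqrt_of_real) simp
    have crit': "critical_point ?V (x, y) \<longleftrightarrow> (x, y) = (0, t) \<or> (x, y) \<in> fst ` set E \<or>
        (x, y) = (X, - (Fy / d)) \<or> (x, y) = (- X, - (Fy / d))" for x y
    proof -
      have "x^2 + y^2 = w^2 \<longleftrightarrow> x^2 = X^2" if "y = - (Fy / d)" using X that by auto
      then have "x \<noteq> 0 \<and> y = - (Fy / d) \<and> x^2 + y^2 = w^2 \<longleftrightarrow>
          y = - (Fy / d) \<and> x \<noteq> 0 \<and> x^2 = X^2"
        by blast
      also have "\<dots> \<longleftrightarrow> (x, y) = (X, - (Fy / d)) \<or> (x, y) = (- X, - (Fy / d))"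
        using X(1) by (auto simp: power2_eq_iff)
      finally show ?thesis unfolding crit by simp
    qed
    have "(- t)^2 < w^2" using less t side by (intro power_strict_mono) auto
    then have "saddle ?V (0, t)" using c0 tb3 w by (intro saddle_y_axis) auto
    moreover have "well ?V (X, - (Fy / d))" "well ?V (- X, - (Fy / d))"
      using crit' X w d by (auto intro!: well_off_y_axis)
    ultimately have "critical_table ?V (N @ map (map_prod real_point id)
        (E @ [((0, t), Saddle), ((X, - (Fy / d)), Well), ((- X, - (Fy / d)), Well)]) @ [])"
      by (intro critical_tableI) (use N E' distinct ne X in \<open>auto simp: crit' sorted_wrt_append\<close>)
    then show ?thesis using less by (simp add: real_point_def y0 xX yw)
  next
    case greater
    have "w < Fy / d" using greater d unfolding sad by (simp add: field_simps)
    then have Fd: "w^2 < (Fy / d)^2" using w by (intro power_strict_mono) auto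
    then have nonreal: "x_well a b Fy \<notin> \<real>" unfolding xw by (intro csqrt_of_neg_real) simp
    have "\<not> x^2 + y^2 = w^2" if "y = - (Fy / d)" for x y
    proof -
      have "x^2 \<ge> 0" "y^2 = (Fy / d)^2" using that by auto
      with Fd show ?thesis by linarith
    qed
    then have crit': "critical_point ?V (x, y) \<longleftrightarrow> (x, y) = (0, t) \<or> (x, y) \<in> fst ` set E" for x y
      unfolding crit by auto
    have "w^2 < (- t)^2" using greater w side by (intro power_strict_mono) auto
    then have "well ?V (0, t)" using c0 tb3 w by (intro well_y_axis) auto
    then have "critical_table ?V (N @ map (map_prod real_point id) (E @ [((0, t), Well)]) @
        [((x_well a b Fy, y_well a b Fy), Nonexistent), ((- x_well a b Fy, y_well a b Fy), Nonexistent)])"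
      by (intro critical_tableI)
        (use N E' distinct ne nonreal in \<open>auto simp: crit' sorted_wrt_append mem_range_real_point_iff\<close>)
    then show ?thesis using greater by (simp add: real_point_def y0)
  next
    case equal
    have Fd: "Fy / d = w" using equal d unfolding sad by simp
    have wt: "- w = t" using equal side by simp
    have crit': "critical_point ?V (x, y) \<longleftrightarrow> (x, y) = (0, t) \<or> (x, y) \<in> fst ` set E" for x y
      unfolding crit Fd by auto
    have "critical_table ?V (N @ map (map_prod real_point id)
        (E @ [((0, t), Unidentified), ((0, t), Unidentified), ((0, t), Unidentified)]) @ [])"
      by (intro critical_tableI) (use N E' distinct ne c0 in \<open>auto simp: crit' sorted_wrt_append\<close>)
    moreover have "x_well a b Fy = 0" unfolding xw Fd by simp
    moreover have "y_well a b Fy = of_real t" unfolding yw Fd wt ..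
    ultimately show ?thesis using equal unfolding y0 by (simp add: real_point_def)
  qed
  show "y_well a b Fy = y0 b Fy \<and> x_well a b Fy = 0" if equal: "Fy = Fy_sad a b"
  proof -
    have Fd: "Fy / d = w" using equal d unfolding sad by simp
    then show ?thesis using side(3) equal unfolding xw yw y0 Fd by simp
  qed
qed

lemma table_Fy_b_lt_half:
  assumes "a > 0" "b > 0" "Fy > 0" "b < 1/2"
  shows "critical_table (V_F a b 0 Fy)
          ((if Fy < Fy_crit b then
              [((0, yk b Fy 1), Saddle),
               ((0, yk b Fy 2), Hill)]
            else if Fy > Fy_crit b then
              [((0, yk b Fy 1), Nonexistent),
               ((0, yk b Fy 2), Nonexistent)]
            else
              [((0, yk b Fy 1), Unidentified),
               ((0, yk b Fy 2), Unidentified)])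
           @
           (if Fy < Fy_sad a b then
              [((0, y0 b Fy), Saddle),
               ((x_well a b Fy, y_well a b Fy), Well),
               ((- x_well a b Fy, y_well a b Fy), Well)]
            else if Fy > Fy_sad a b then
              [((0, y0 b Fy), Well),
               ((x_well a b Fy, y_well a b Fy), Nonexistent),
               ((- x_well a b Fy, y_well a b Fy), Nonexistent)]
            else
              [((0, y0 b Fy), Unidentified),
               ((x_well a b Fy, y_well a b Fy), Unidentified),
               ((- x_well a b Fy, y_well a b Fy), Unidentified)]))"
    (is "critical_table ?V (_ @ ?T)")
proof -
  have c: "1 - 2*b > 0" and ab: "a + b > 0" using assms by auto
  define m where "m = sqrt ((1 - 2*b) / 3)"
  have m: "m > 0" "m^2 = (1 - 2*b) / 3" using c by (auto simp: m_def)
  have y0: "y0 b Fy = trig_root (1 - 2*b) Fy 0" using assms by (simp add: y0_def yk_def)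
  consider (less) "Fy < Fy_crit b" | (greater) "Fy > Fy_crit b" | (equal) "Fy = Fy_crit b" by linarith
  then show ?thesis
  proof cases
    case less
    from trig_roots_below_crit[OF c assms(3) less[unfolded Fy_crit_def], folded m_def] obtain t\<^sub>0 t\<^sub>1 t\<^sub>2 where
      r: "y0 b Fy = of_real t\<^sub>0" "yk b Fy 1 = of_real t\<^sub>1" "yk b Fy 2 = of_real t\<^sub>2"
      and t: "t\<^sub>0 < 0" "0 < t\<^sub>2" "t\<^sub>2 < m" "m < t\<^sub>1"
      and f: "\<And>t. t^3 - (1 - 2*b) * t + Fy = (t - t\<^sub>0) * (t - t\<^sub>1) * (t - t\<^sub>2)"
      unfolding yk_def y0 by metis
    have crit: "critical_point ?V (0, t\<^sub>1)" "critical_point ?V (0, t\<^sub>2)"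
      using f[of t\<^sub>1] f[of t\<^sub>2] by (simp_all add: critical_point_Fx_0_iff[OF ab])
    have t1: "t\<^sub>1 > 0" using t m by linarith
    have "t\<^sub>1 * (t\<^sub>1^2 - (1 - 2*b)) < 0"
      using f[of t\<^sub>1] assms(3) by (simp add: algebra_simps power2_eq_square power3_eq_cube)
    then have "t\<^sub>1^2 < 1 - 2*b" using t1 by (simp add: mult_less_0_iff)
    moreover have "m^2 < t\<^sub>1^2" "t\<^sub>2^2 < m^2" using t m by (auto intro!: power_strict_mono)
    ultimately have "saddle ?V (0, t\<^sub>1)" "hill ?V (0, t\<^sub>2)"
      using crit m assms(1,2) by (auto intro!: saddle_y_axis hill_y_axis)
    then have "critical_table ?V (([] @ map (map_prod real_point id)
        [((0, t\<^sub>1), Saddle), ((0, t\<^sub>2), Hill)]) @ ?T)"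
      using t t1 by (intro table_Fx_0[OF assms(1-3) r(1) t(1)]) (auto simp: f)
    then show ?thesis using less by (simp add: real_point_def r del: One_nat_def)
  next
    case greater
    from trig_roots_above_crit[OF c assms(3) greater[unfolded Fy_crit_def]] obtain t where
      r: "y0 b Fy = of_real t" "yk b Fy 1 \<notin> \<real>" "yk b Fy 2 \<notin> \<real>" "t < 0"
      and f: "\<And>u. u^3 - (1 - 2*b) * u + Fy = 0 \<longleftrightarrow> u = t"
      unfolding yk_def y0 by metis
    have "critical_table ?V (([((0, yk b Fy 1), Nonexistent), ((0, yk b Fy 2), Nonexistent)] @
        map (map_prod real_point id) []) @ ?T)"
      using r by (intro table_Fx_0[OF assms(1-3) r(1) r(4)]) (auto simp: f mem_range_real_point_iff)
    then show ?thesis using greater by simp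
  next
    case equal
    note r = trig_roots_at_crit[OF c assms(3) equal[unfolded Fy_crit_def], folded m_def]
    have f: "\<And>u. u^3 - (1 - 2*b) * u + Fy = 0 \<longleftrightarrow> u = - 2 * m \<or> u = m" by (rule r(4))
    have "critical_point ?V (0, m)" using f[of m] by (simp add: critical_point_Fx_0_iff[OF ab])
    then have "critical_table ?V (([] @ map (map_prod real_point id)
        [((0, m), Unidentified), ((0, m), Unidentified)]) @ ?T)"
      using m by (intro table_Fx_0[OF assms(1-3) trans[OF y0 r(1)]])
        (auto simp: f)
    then show ?thesis using equal r(2,3) by (simp add: real_point_def yk_def)
  qed
qed

text \<open>
  For \<open>b \<ge> 1/2\<close> any nonzero root \<open>t\<close> satisfies \<open>4*(1 - 2*b) \<le> 0 < 3*t^2\<close>, so a root provided by the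
  intermediate value theorem is the only one.
\<close>

lemma y0_unique_root:
  assumes "b \<ge> 1/2" "Fy > 0"
  obtains t where "y0 b Fy = of_real t" "t < 0" "\<And>u. u^3 - (1 - 2*b) * u + Fy = 0 \<longleftrightarrow> u = t"
proof -
  define f where "f = (\<lambda>u::real. u^3 - (1 - 2*b) * u + Fy)"
  have "\<exists>t. - (Fy + 1) \<le> t \<and> t \<le> 0 \<and> f t = 0"
  proof (rule IVT')
    \<comment> \<open>\<open>- (Fy + 1)\<close> is negative enough: its cube alone outweighs \<open>Fy\<close>\<close>
    have "(Fy + 1)^1 \<le> (Fy + 1)^3" using assms by (intro power_increasing) auto
    moreover have "(2*b - 1) * (Fy + 1) \<ge> 0" using assms by simp
    moreover have "f (- (Fy + 1)) = Fy - (Fy + 1)^3 - (2*b - 1) * (Fy + 1)"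
      by (simp add: f_def power3_eq_cube algebra_simps)
    ultimately show "f (- (Fy + 1)) \<le> 0" by simp
    show "0 \<le> f 0" "- (Fy + 1) \<le> 0" using assms by (auto simp: f_def)
    show "continuous_on {- (Fy + 1)..0} f" unfolding f_def by (intro continuous_intros)
  qed
  then obtain t where "t \<le> 0" "f t = 0" by blast
  moreover have "f 0 > 0" using assms by (simp add: f_def)
  ultimately have t: "t < 0" by (cases "t = 0") auto
  have "t^2 > 0" using t by simp
  then have "4 * (1 - 2*b) < 3 * t^2" using assms(1) by argo
  then have uniq: "u^3 - (1 - 2*b) * u + Fy = 0 \<longleftrightarrow> u = t" for u
    using \<open>f t = 0\<close> by (intro cubic_unique_root) (simp_all add: f_def)
  have "y0 b Fy = of_real t" using assms(1) by (simp add: y0_def uniq)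
  with t uniq show ?thesis by (intro that)
qed

lemma tables_Fy_b_ge_half:
  assumes "a > 0" "b > 0" "Fy > 0" "b \<ge> 1/2"
  shows "Fy < Fy_sad a b \<Longrightarrow>
          critical_table (V_F a b 0 Fy)
            [((0, y0 b Fy), Saddle),
             ((x_well a b Fy, y_well a b Fy), Well),
             ((- x_well a b Fy, y_well a b Fy), Well)]"
    and "Fy = Fy_sad a b \<Longrightarrow>
          (0, y0 b Fy) = (x_well a b Fy, y_well a b Fy) \<and>
          (0, y0 b Fy) = (- x_well a b Fy, y_well a b Fy) \<and>
          critical_table (V_F a b 0 Fy)
            [((0, y0 b Fy), Unidentified),
             ((x_well a b Fy, y_well a b Fy), Unidentified),
             ((- x_well a b Fy, y_well a b Fy), Unidentified)]"
    and "Fy > Fy_sad a b \<Longrightarrow>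
          critical_table (V_F a b 0 Fy)
            [((0, y0 b Fy), Well),
             ((x_well a b Fy, y_well a b Fy), Nonexistent),
             ((- x_well a b Fy, y_well a b Fy), Nonexistent)]"
proof -
  obtain t where t: "y0 b Fy = of_real t" "t < 0"
    and uniq: "\<And>u. u^3 - (1 - 2*b) * u + Fy = 0 \<longleftrightarrow> u = t"
    using y0_unique_root[OF assms(4,3)] by metis
  note table = table_Fx_0[OF assms(1-3) t, of "[]" "[]"]
  show "critical_table (V_F a b 0 Fy)
            [((0, y0 b Fy), Saddle),
             ((x_well a b Fy, y_well a b Fy), Well),
             ((- x_well a b Fy, y_well a b Fy), Well)]" if "Fy < Fy_sad a b"
    using table(1) uniq that by simp
  show "(0, y0 b Fy) = (x_well a b Fy, y_well a b Fy) \<and>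
          (0, y0 b Fy) = (- x_well a b Fy, y_well a b Fy) \<and>
          critical_table (V_F a b 0 Fy)
            [((0, y0 b Fy), Unidentified),
             ((x_well a b Fy, y_well a b Fy), Unidentified),
             ((- x_well a b Fy, y_well a b Fy), Unidentified)]" if "Fy = Fy_sad a b"
    using table uniq that by simp
  show "critical_table (V_F a b 0 Fy)
            [((0, y0 b Fy), Well),
             ((x_well a b Fy, y_well a b Fy), Nonexistent),
             ((- x_well a b Fy, y_well a b Fy), Nonexistent)]" if "Fy > Fy_sad a b"
    using table(1) uniq that by simp
qed

section \<open>The classification\<close>

theorem theorem5p1:
  fixes a b Fx Fy :: real
  assumes "a > 0" "b > 0" "Fx \<ge> 0" "Fy \<ge> 0"
  shows
    "
    \<comment> \<open>(A)\<close>
    (Fx = 0 \<and> Fy = 0 \<and> b < 1/2 \<longrightarrow>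
        critical_table (V_F a b Fx Fy)
          [((0, 0), Hill),
           ((complex_of_real (sqrt (1 + 2*a)), 0), Well),
           ((- complex_of_real (sqrt (1 + 2*a)), 0), Well),
           ((0, complex_of_real (sqrt (1 - 2*b))), Saddle),
           ((0, - complex_of_real (sqrt (1 - 2*b))), Saddle)]) \<and>
    \<comment> \<open>(B)\<close>
    (Fx = 0 \<and> Fy = 0 \<and> b \<ge> 1/2 \<longrightarrow>
        critical_table (V_F a b Fx Fy)
          [((0, 0), Saddle),
           ((complex_of_real (sqrt (1 + 2*a)), 0), Well),
           ((- complex_of_real (sqrt (1 + 2*a)), 0), Well)]) \<and>
    \<comment> \<open>(C)\<close>
    (Fx > 0 \<and> Fy = 0 \<and> b < 1/2 \<longrightarrow>
        has_nature (V_F a b Fx Fy) (xk a Fx 0, 0) Well \<and>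
        (Fx < Fx_sad a b \<longrightarrow>
          critical_table (V_F a b Fx Fy)
            [((xk a Fx 0, 0), Well),
             ((xk a Fx 1, 0), Well),
             ((xk a Fx 2, 0), Hill),
             ((x_saddle a b Fx, y_saddle a b Fx), Saddle),
             ((x_saddle a b Fx, - y_saddle a b Fx), Saddle)]) \<and>
        (Fx_sad a b < Fx \<and> Fx < Fx_crit a \<longrightarrow>
          (sqrt (1 - 2*b) \<in> R1 a \<longrightarrow>
            critical_table (V_F a b Fx Fy)
              [((xk a Fx 0, 0), Well),
               ((xk a Fx 1, 0), Saddle),
               ((xk a Fx 2, 0), Hill),
               ((x_saddle a b Fx, y_saddle a b Fx), Nonexistent),
               ((x_saddle a b Fx, - y_saddle a b Fx), Nonexistent)]) \<and>
          (sqrt (1 - 2*b) \<in> R2 a \<longrightarrow>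
            critical_table (V_F a b Fx Fy)
              [((xk a Fx 0, 0), Well),
               ((xk a Fx 1, 0), Well),
               ((xk a Fx 2, 0), Saddle),
               ((x_saddle a b Fx, y_saddle a b Fx), Nonexistent),
               ((x_saddle a b Fx, - y_saddle a b Fx), Nonexistent)])) \<and>
        (Fx = Fx_sad a b \<and> Fx_sad a b < Fx_crit a \<longrightarrow>
          (sqrt (1 - 2*b) \<in> R1 a \<longrightarrow>
            critical_table (V_F a b Fx Fy)
              [((xk a Fx 0, 0), Well),
               ((xk a Fx 1, 0), Unidentified),
               ((xk a Fx 2, 0), Hill),
               ((x_saddle a b Fx, y_saddle a b Fx), Unidentified),
               ((x_saddle a b Fx, - y_saddle a b Fx), Unidentified)]) \<and>
          (sqrt (1 - 2*b) \<in> R2 a \<longrightarrow>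
            critical_table (V_F a b Fx Fy)
              [((xk a Fx 0, 0), Well),
               ((xk a Fx 1, 0), Well),
               ((xk a Fx 2, 0), Unidentified),
               ((x_saddle a b Fx, y_saddle a b Fx), Unidentified),
               ((x_saddle a b Fx, - y_saddle a b Fx), Unidentified)])) \<and>
        (Fx = Fx_crit a \<longrightarrow>
          critical_table (V_F a b Fx Fy)
            [((xk a Fx 0, 0), Well),
             ((xk a Fx 1, 0), Unidentified),
             ((xk a Fx 2, 0), Unidentified)]) \<and>
        (Fx > Fx_crit a \<longrightarrow>
          critical_table (V_F a b Fx Fy)
            [((xk a Fx 0, 0), Well),
             ((xk a Fx 1, 0), Nonexistent),
             ((xk a Fx 2, 0), Nonexistent)])) \<and>
    \<comment> \<open>(D)\<close>
    (Fx > 0 \<and> Fy = 0 \<and> b \<ge> 1/2 \<longrightarrow>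
        (Fx < Fx_crit a \<longrightarrow>
          critical_table (V_F a b Fx Fy)
            [((xk a Fx 0, 0), Well),
             ((xk a Fx 1, 0), Well),
             ((xk a Fx 2, 0), Saddle)]) \<and>
        (Fx > Fx_crit a \<longrightarrow>
          critical_table (V_F a b Fx Fy)
            [((xk a Fx 0, 0), Well),
             ((xk a Fx 1, 0), Nonexistent),
             ((xk a Fx 2, 0), Nonexistent)]) \<and>
        (Fx = Fx_crit a \<longrightarrow>
          critical_table (V_F a b Fx Fy)
            [((xk a Fx 0, 0), Well),
             ((xk a Fx 1, 0), Unidentified),
             ((xk a Fx 2, 0), Unidentified)])) \<and>
    \<comment> \<open>(E): the position of Fy relative to Fy_crit and relative to Fy_sad is independent,
       and each comparison determines a part of the table\<close>
    (Fx = 0 \<and> Fy > 0 \<and> b < 1/2 \<longrightarrow>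
        critical_table (V_F a b Fx Fy)
          ((if Fy < Fy_crit b then
              [((0, yk b Fy 1), Saddle),
               ((0, yk b Fy 2), Hill)]
            else if Fy > Fy_crit b then
              [((0, yk b Fy 1), Nonexistent),
               ((0, yk b Fy 2), Nonexistent)]
            else
              [((0, yk b Fy 1), Unidentified),
               ((0, yk b Fy 2), Unidentified)])
           @
           (if Fy < Fy_sad a b then
              [((0, y0 b Fy), Saddle),
               ((x_well a b Fy, y_well a b Fy), Well),
               ((- x_well a b Fy, y_well a b Fy), Well)]
            else if Fy > Fy_sad a b then
              [((0, y0 b Fy), Well),
               ((x_well a b Fy, y_well a b Fy), Nonexistent),
               ((- x_well a b Fy, y_well a b Fy), Nonexistent)]
            else
              [((0, y0 b Fy), Unidentified),
               ((x_well a b Fy, y_well a b Fy), Unidentified),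
               ((- x_well a b Fy, y_well a b Fy), Unidentified)]))) \<and>
    \<comment> \<open>(F)\<close>
    (Fx = 0 \<and> Fy > 0 \<and> b \<ge> 1/2 \<longrightarrow>
        (Fy < Fy_sad a b \<longrightarrow>
          critical_table (V_F a b Fx Fy)
            [((0, y0 b Fy), Saddle),
             ((x_well a b Fy, y_well a b Fy), Well),
             ((- x_well a b Fy, y_well a b Fy), Well)]) \<and>
        (Fy = Fy_sad a b \<longrightarrow>
          (0, y0 b Fy) = (x_well a b Fy, y_well a b Fy) \<and>
          (0, y0 b Fy) = (- x_well a b Fy, y_well a b Fy) \<and>
          critical_table (V_F a b Fx Fy)
            [((0, y0 b Fy), Unidentified),
             ((x_well a b Fy, y_well a b Fy), Unidentified),
             ((- x_well a b Fy, y_well a b Fy), Unidentified)]) \<and>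
        (Fy > Fy_sad a b \<longrightarrow>
          critical_table (V_F a b Fx Fy)
            [((0, y0 b Fy), Well),
             ((x_well a b Fy, y_well a b Fy), Nonexistent),
             ((- x_well a b Fy, y_well a b Fy), Nonexistent)]))"
proof ((intro conjI; intro impI; elim conjE), goal_cases)
  case 1
  then show ?case using tables_no_force(1)[OF assms(1,2)] by simp
next
  case 2
  then show ?case using tables_no_force(2)[OF assms(1,2)] by simp
next
  case 3
  then show ?case
    by (simp only:)
      (intro conjI impI xk_0_well[OF assms(1,2)] table_Fx_lt_sad[OF assms(1,2)]
        tables_Fx_between_sad_and_crit[OF assms(1,2)] tables_Fx_eq_sad[OF assms(1,2)]
        table_Fx_eq_crit[OF assms(1,2)] table_Fx_gt_crit[OF assms(1,2)]; (elim conjE)?; simp)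
next
  case 4
  then show ?case
    by (simp only:)
      (intro conjI impI table_Fx_lt_crit_b_ge_half[OF assms(1,2)]
        table_Fx_eq_crit[OF assms(1,2)] table_Fx_gt_crit[OF assms(1,2)]; simp)
next
  case 5
  then show ?case using table_Fy_b_lt_half[OF assms(1,2)] by (simp only:)
next
  case 6
  then have "Fx = 0" and F: "Fy > 0" "b \<ge> 1/2" by simp_all
  show ?case
    unfolding \<open>Fx = 0\<close> using tables_Fy_b_ge_half[OF assms(1,2) F] by blast
qed

end
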